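(* Suppose that $q_0$ is locally smooth at $\boldsymbol U_0^*$ with parameters $\varepsilon,L>0$ independent of $V$, i.e. $q_0(\boldsymbol U_0^* )\ge q_0(\boldsymbol U)+L\|\boldsymbol U-\boldsymbol U_0^*\|^2$ for all $\boldsymbol U\succeq\boldsymbol 0$ with $\|\boldsymbol U-\boldsymbol U_0^*\|<\varepsilon$, and that a steady state distribution exists for the backlog process under QLA. Then FQLA-Ideal (with $\mathcal W_j=\max[U^*_{Vj}-\log^2(V)\sqrt V,0]$) achieves an $[O(1/V),O(\log^2(V)\sqrt V)]$ performance-delay tradeoff, i.e. its time average cost is $f^*_{av}+O(1/V)$ and its time average backlog is $O(\log^2(V)\sqrt V)$, with $P_{drop}=O(1/V^{c_0\log(V)})$, where $c_0=\Theta(1)$. Similarly, for appropriately chosen $T$, FQLA-General (with $\mathcal W_j=\max[W_j(T)-\log^2(V)\sqrt V,0]$) achieves the same performance with probability $1-O(1/V^4)$.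
   Context: Network model. Time is slotted, $t=0,1,2,\dots$; there are $r\ge1$ queues. The network state $S(t)$ takes values in a finite set $\mathcal S=\{s_1,\dots,s_M\}$ and is i.i.d. over slots with $p_{s_i}=\Pr\{S(t)=s_i\}$. When $S(t)=s_i$, the controller observes $s_i$ and chooses an action $x$ in a compact feasible set $\mathcal X^{(s_i)}$; this incurs cost $f(t)=f(s_i,x)$ (the function $f$ is either everywhere nonnegative or everywhere nonpositive), arrivals $A_j(t)=g_j(s_i,x)\ge0$ to queue $j$ and service $\mu_j(t)=b_j(s_i,x)\ge0$ of queue $j$, $j=1,\dots,r$. The magnitudes of $f,g_j,b_j$ are bounded by a constant $\delta_{max}\in(0,\infty)$. Slackness: there are actions $x^{(s_i)k}\in\mathcal X^{(s_i)}$, $k=1,\dots,r+2$, and weights $\vartheta_k^{(s_i)}\ge0$ with $\sum_k\vartheta_k^{(s_i)}=1$ for each $s_i$, and some $\epsilon_s>0$, such that $\sum_{s_i}p_{s_i}\sum_k\vartheta_k^{(s_i)}[g_j(s_i,x^{(s_i)k})-b_j(s_i,x^{(s_i)k})]\le-\epsilon_s$ for all $j$. The backlog vector $\boldsymbol U(t)=(U_1(t),\dots,U_r(t))^T$ (without packet dropping) satisfies $\boldsymbol U(0)=\boldsymbol 0$ and $U_j(t+1)=\max[U_j(t)-\mu_j(t),0]+A_j(t)$. $\|\cdot\|$ is the Euclidean norm, $\succeq$ is entrywise. Averages: time average backlog $\overline U=\limsup_{t\to\infty}\frac1t\sum_{\tau=0}^{t-1}\sum_j\mathbb E\{U_j(\tau)\}$;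 time average cost of a policy $\pi$ is $f^\pi_{av}=\limsup_{t\to\infty}\frac1t\sum_{\tau=0}^{t-1}\mathbb E\{f^\pi(\tau)\}$. A policy is stable if its time average backlog (without packet dropping) is finite; $f^*_{av}$ is the optimal (infimum) time average cost over all stable policies. QLA with parameter $V\ge1$: at each slot $t$, given $\boldsymbol U(t)$ and $S(t)=s_i$, choose $x\in\mathcal X^{(s_i)}$ maximizing $-Vf(s_i,x)+\sum_jU_j(t)[b_j(s_i,x)-g_j(s_i,x)]$. Dual function: $q(\boldsymbol U)=\inf_{x^{(s_i)}\in\mathcal X^{(s_i)}}\sum_{s_i}p_{s_i}\{Vf(s_i,x^{(s_i)})+\sum_jU_j[g_j(s_i,x^{(s_i)})-b_j(s_i,x^{(s_i)})]\}$; its maximizer over $\boldsymbol U\succeq\boldsymbol 0$ is $\boldsymbol U_V^*=(U^*_{V1},\dots,U^*_{Vr})^T$, assumed unique for every $V\ge1$. $q_0$ and $\boldsymbol U_0^*$ denote $q$ and its maximizer when $V=1$. FQLA (locally smooth version). Step I: FQLA-Ideal knows $\boldsymbol U_V^*$ and sets $\mathcal W_j=\max[U^*_{Vj}-\log^2(V)\sqrt V,0]$. FQLA-General chooses a time $T$, runs QLA with parameter $V$ from $\boldsymbol W(0)=\boldsymbol 0$ on the backlog $\boldsymbol W(t)$ to obtain $\boldsymbol W(T)$, and sets $\mathcal W_j=\max[W_j(T)-\log^2(V)\sqrt V,0]$; "appropriately chosen $T$" means large enough that the system is in steady state at time $T$. Step II (time indexed from $0$): initialize $U_j(0)=0$,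 $W_j(0)=\mathcal W_j$ for all $j$. At each slot $t\ge 0$, observe $S(t)=s_i$ and choose $x\in\mathcal X^{(s_i)}$ maximizing the QLA objective with $\boldsymbol W(t)$ in place of $\boldsymbol U(t)$; let $A_j(t),\mu_j(t)$ be the resulting arrivals and services and $f(t)$ the cost. For each queue $j$: (a) if $W_j(t)\ge\mathcal W_j$, set $U_j(t+1)=\max[U_j(t)-\mu_j(t),0]+A_j(t)$; (b) if $W_j(t)<\mathcal W_j$, admit only $\tilde A_j(t)=\max[A_j(t)-\mathcal W_j+W_j(t),0]$ arrivals (the other $A_j(t)-\tilde A_j(t)$ packets are dropped) and set $U_j(t+1)=\max[U_j(t)-\mu_j(t),0]+\tilde A_j(t)$; (c) in all cases set $W_j(t+1)=\max[W_j(t)-\mu_j(t),0]+A_j(t)$. For FQLA-General the probability is over the sample $\boldsymbol W(T)$, and averages are those of Step II for the resulting $\mathcal W_j$. $P_{drop}$, the time average fraction of packets dropped in Step II(b), is the long-run ratio of $\sum_{\tau<t}\sum_j\mathbb E\{A_j(\tau)-\tilde A_j(\tau)\}$ to $\sum_{\tau<t}\sum_j\mathbb E\{A_j(\tau)\}$. Asymptotic notation refers to $V\to\infty$ with all other problem data fixed.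
   Formalization: The bound on P_drop is claimed only when the total expected arrivals of Step II tend to infinity; if the chain is absorbed in an idle state, total arrivals stay finite and drops in the first slots can make the ratio of order 1/(log^2(V) sqrt V), so the literal bound fails. *)

theory Defs
  imports "HOL-Probability.Probability"
begin

section \<open>The network\<close>

record ('s, 'x, 'r::finite) network =
  law :: "'s pmf"
  acts :: "'s \<Rightarrow> 'x set"
  cost :: "'s \<Rightarrow> 'x \<Rightarrow> real"
  arr :: "'s \<Rightarrow> 'x \<Rightarrow> real ^ 'r"
  srv :: "'s \<Rightarrow> 'x \<Rightarrow> real ^ 'r"

definition slackness :: "('s::finite, 'x, 'r::finite) network \<Rightarrow> bool" where
  "slackness N \<longleftrightarrow>
     (\<exists>(y :: 's \<Rightarrow> nat \<Rightarrow> 'x) (\<theta> :: 's \<Rightarrow> nat \<Rightarrow> real) (\<epsilon>s :: real).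
        \<epsilon>s > 0 \<and>
        (\<forall>s. \<forall>k\<in>{1..CARD('r) + 2}. y s k \<in> acts N s \<and> 0 \<le> \<theta> s k) \<and>
        (\<forall>s. (\<Sum>k=1..CARD('r) + 2. \<theta> s k) = 1) \<and>
        (\<forall>j. (\<Sum>s\<in>UNIV. pmf (law N) s *
               (\<Sum>k=1..CARD('r) + 2. \<theta> s k * (arr N s (y s k) $ j - srv N s (y s k) $ j)))
             \<le> - \<epsilon>s))"

definition network_model :: "('s::finite, 'x::topological_space, 'r::finite) network \<Rightarrow> bool" where
  "network_model N \<longleftrightarrow>
     (\<forall>s. compact (acts N s)) \<and>
     ((\<forall>s. \<forall>x\<in>acts N s. 0 \<le> cost N s x) \<or> (\<forall>s. \<forall>x\<in>acts N s. cost N s x \<le> 0)) \<and>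
     (\<forall>s. \<forall>x\<in>acts N s. \<forall>j. 0 \<le> arr N s x $ j \<and> 0 \<le> srv N s x $ j) \<and>
     (\<exists>\<delta>>0. \<forall>s. \<forall>x\<in>acts N s.
        \<bar>cost N s x\<bar> \<le> \<delta> \<and> (\<forall>j. \<bar>arr N s x $ j\<bar> \<le> \<delta> \<and> \<bar>srv N s x $ j\<bar> \<le> \<delta>)) \<and>
     slackness N"

text \<open>
  A sample point assigns to every slot the network state and an independent number drawn
  uniformly from the unit interval. The latter is the source of randomness available to
  randomized policies.
\<close>

definition sample :: "('s, 'x, 'r::finite) network \<Rightarrow> (nat \<Rightarrow> 's \<times> real) measure" where
  "sample N =
     Pi\<^sub>M UNIV (\<lambda>_. measure_pmf (law N) \<Otimes>\<^sub>M uniform_measure lborel {0..1})"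

abbreviation expect ::
  "('s, 'x, 'r::finite) network \<Rightarrow> ((nat \<Rightarrow> 's \<times> real) \<Rightarrow> real) \<Rightarrow> real" where
  "expect N h \<equiv> integral\<^sup>L (sample N) h"

definition tavg :: "(nat \<Rightarrow> real) \<Rightarrow> ereal" where
  "tavg h = limsup (\<lambda>t. ereal ((1 / real t) * (\<Sum>\<tau><t. h \<tau>)))"

definition queue_update :: "real ^ 'r \<Rightarrow> real ^ 'r \<Rightarrow> real ^ 'r \<Rightarrow> real ^ 'r" where
  "queue_update u \<mu> a = (\<chi> j. max (u $ j - \<mu> $ j) 0 + a $ j)"


section \<open>Policies and the optimal time average cost\<close>

type_synonym ('s, 'x) policy = "nat \<Rightarrow> (nat \<Rightarrow> 's \<times> real) \<Rightarrow> 'x"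

text \<open>Policies may be randomized and may depend on the whole past, but not on future slots.\<close>

definition policy :: "('s, 'x, 'r::finite) network \<Rightarrow> ('s, 'x) policy \<Rightarrow> bool" where
  "policy N \<phi> \<longleftrightarrow>
     (\<forall>t \<omega>. \<phi> t \<omega> \<in> acts N (fst (\<omega> t))) \<and>
     (\<forall>t \<omega> \<omega>'. (\<forall>i\<le>t. \<omega> i = \<omega>' i) \<longrightarrow> \<phi> t \<omega> = \<phi> t \<omega>') \<and>
     (\<forall>t. (\<lambda>\<omega>. cost N (fst (\<omega> t)) (\<phi> t \<omega>)) \<in> borel_measurable (sample N) \<and>
          (\<lambda>\<omega>. arr N (fst (\<omega> t)) (\<phi> t \<omega>)) \<in> borel_measurable (sample N) \<and>
          (\<lambda>\<omega>. srv N (fst (\<omega> t)) (\<phi> t \<omega>)) \<in> borel_measurable (sample N))"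

primrec backlog ::
  "('s, 'x, 'r::finite) network \<Rightarrow> ('s, 'x) policy \<Rightarrow> nat \<Rightarrow> (nat \<Rightarrow> 's \<times> real) \<Rightarrow> real ^ 'r" where
  "backlog N \<phi> 0 \<omega> = 0"
| "backlog N \<phi> (Suc t) \<omega> =
     queue_update (backlog N \<phi> t \<omega>) (srv N (fst (\<omega> t)) (\<phi> t \<omega>)) (arr N (fst (\<omega> t)) (\<phi> t \<omega>))"

definition avg_backlog :: "('s, 'x, 'r::finite) network \<Rightarrow> ('s, 'x) policy \<Rightarrow> ereal" where
  "avg_backlog N \<phi> = tavg (\<lambda>t. \<Sum>j\<in>UNIV. expect N (\<lambda>\<omega>. backlog N \<phi> t \<omega> $ j))"

definition avg_cost :: "('s, 'x, 'r::finite) network \<Rightarrow> ('s, 'x) policy \<Rightarrow> ereal" where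
  "avg_cost N \<phi> = tavg (\<lambda>t. expect N (\<lambda>\<omega>. cost N (fst (\<omega> t)) (\<phi> t \<omega>)))"

definition stable :: "('s, 'x, 'r::finite) network \<Rightarrow> ('s, 'x) policy \<Rightarrow> bool" where
  "stable N \<phi> \<longleftrightarrow> avg_backlog N \<phi> < \<infinity>"

definition opt_cost :: "('s, 'x, 'r::finite) network \<Rightarrow> ereal" where
  "opt_cost N = (INF \<phi>\<in>{\<phi>. policy N \<phi> \<and> stable N \<phi>}. avg_cost N \<phi>)"


section \<open>The dual function\<close>

definition dual :: "('s::finite, 'x, 'r::finite) network \<Rightarrow> real \<Rightarrow> real ^ 'r \<Rightarrow> real" where
  "dual N V U =
     (INF \<xi>\<in>{\<xi>. \<forall>s. \<xi> s \<in> acts N s}.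
        \<Sum>s\<in>UNIV. pmf (law N) s *
          (V * cost N s (\<xi> s) + (\<Sum>j\<in>UNIV. U $ j * (arr N s (\<xi> s) $ j - srv N s (\<xi> s) $ j))))"

definition dual_maximizer ::
  "('s::finite, 'x, 'r::finite) network \<Rightarrow> real \<Rightarrow> real ^ 'r \<Rightarrow> bool" where
  "dual_maximizer N V U \<longleftrightarrow>
     (\<forall>j. 0 \<le> U $ j) \<and> (\<forall>U'. (\<forall>j. 0 \<le> U' $ j) \<longrightarrow> dual N V U' \<le> dual N V U)"

definition dual_opt :: "('s::finite, 'x, 'r::finite) network \<Rightarrow> real \<Rightarrow> real ^ 'r" where
  "dual_opt N V = (THE U. dual_maximizer N V U)"

definition locally_smooth ::
  "('s::finite, 'x, 'r::finite) network \<Rightarrow> real \<Rightarrow> real \<Rightarrow> bool" where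
  "locally_smooth N \<epsilon> L \<longleftrightarrow>
     (\<forall>U. (\<forall>j. 0 \<le> U $ j) \<and> norm (U - dual_opt N 1) < \<epsilon> \<longrightarrow>
        dual N 1 (dual_opt N 1) \<ge> dual N 1 U + L * (norm (U - dual_opt N 1))\<^sup>2)"


section \<open>QLA\<close>

definition qla_objective ::
  "('s, 'x, 'r::finite) network \<Rightarrow> real \<Rightarrow> real ^ 'r \<Rightarrow> 's \<Rightarrow> 'x \<Rightarrow> real" where
  "qla_objective N V w s x =
     - V * cost N s x + (\<Sum>j\<in>UNIV. w $ j * (srv N s x $ j - arr N s x $ j))"

text \<open>
  \<open>\<sigma> w s\<close> is the action taken at backlog \<open>w\<close> in state \<open>s\<close>; ties are broken arbitrarily.
\<close>

definition qla_rule ::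
  "('s, 'x, 'r::finite) network \<Rightarrow> real \<Rightarrow> (real ^ 'r \<Rightarrow> 's \<Rightarrow> 'x) \<Rightarrow> bool" where
  "qla_rule N V \<sigma> \<longleftrightarrow>
     (\<forall>w s. (\<forall>j. 0 \<le> w $ j) \<longrightarrow>
        \<sigma> w s \<in> acts N s \<and>
        (\<forall>x\<in>acts N s. qla_objective N V w s x \<le> qla_objective N V w s (\<sigma> w s)))"

primrec qla_backlog ::
  "('s, 'x, 'r::finite) network \<Rightarrow> (real ^ 'r \<Rightarrow> 's \<Rightarrow> 'x) \<Rightarrow> real ^ 'r \<Rightarrow> nat \<Rightarrow>
     (nat \<Rightarrow> 's \<times> real) \<Rightarrow> real ^ 'r" where
  "qla_backlog N \<sigma> w0 0 \<omega> = w0"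
| "qla_backlog N \<sigma> w0 (Suc t) \<omega> =
     (let w = qla_backlog N \<sigma> w0 t \<omega>; s = fst (\<omega> t); x = \<sigma> w s
      in queue_update w (srv N s x) (arr N s x))"

text \<open>
  A steady state distribution is a weak limit of the time-averaged laws of the backlog process
  started from the empty network. Averaging over time admits periodic chains; if the laws
  themselves converge, the limit is the same.
\<close>

definition has_steady_state ::
  "('s, 'x, 'r::finite) network \<Rightarrow> (real ^ 'r \<Rightarrow> 's \<Rightarrow> 'x) \<Rightarrow> bool" where
  "has_steady_state N \<sigma> \<longleftrightarrow>
     (\<exists>\<pi> :: (real ^ 'r) measure. prob_space \<pi> \<and> sets \<pi> = sets borel \<and>
        (\<forall>h :: real ^ 'r \<Rightarrow> real. continuous_on UNIV h \<and> bounded (range h) \<longrightarrow>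
           (\<lambda>t. (1 / real t) * (\<Sum>\<tau><t. expect N (\<lambda>\<omega>. h (qla_backlog N \<sigma> 0 \<tau> \<omega>))))
             \<longlonglongrightarrow> integral\<^sup>L \<pi> h))"


section \<open>FQLA\<close>

definition threshold :: "real \<Rightarrow> real ^ 'r \<Rightarrow> real ^ 'r" where
  "threshold V w = (\<chi> j. max (w $ j - (ln V)\<^sup>2 * sqrt V) 0)"

definition ideal_threshold ::
  "('s::finite, 'x, 'r::finite) network \<Rightarrow> real \<Rightarrow> real ^ 'r" where
  "ideal_threshold N V = threshold V (dual_opt N V)"

definition general_threshold ::
  "('s, 'x, 'r::finite) network \<Rightarrow> real \<Rightarrow> (real ^ 'r \<Rightarrow> 's \<Rightarrow> 'x) \<Rightarrow> nat \<Rightarrow>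
     (nat \<Rightarrow> 's \<times> real) \<Rightarrow> real ^ 'r" where
  "general_threshold N V \<sigma> T \<omega> = threshold V (qla_backlog N \<sigma> 0 T \<omega>)"

text \<open>
  In Step II the process \<open>W\<close> evolves, and the actions are chosen, exactly as under QLA started
  from \<open>W(0) = \<W>\<close>.
\<close>

definition fqla_policy ::
  "('s, 'x, 'r::finite) network \<Rightarrow> (real ^ 'r \<Rightarrow> 's \<Rightarrow> 'x) \<Rightarrow> real ^ 'r \<Rightarrow> ('s, 'x) policy" where
  "fqla_policy N \<sigma> \<W> t \<omega> = \<sigma> (qla_backlog N \<sigma> \<W> t \<omega>) (fst (\<omega> t))"

definition fqla_arr ::
  "('s, 'x, 'r::finite) network \<Rightarrow> (real ^ 'r \<Rightarrow> 's \<Rightarrow> 'x) \<Rightarrow> real ^ 'r \<Rightarrow> nat \<Rightarrow>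
     (nat \<Rightarrow> 's \<times> real) \<Rightarrow> real ^ 'r" where
  "fqla_arr N \<sigma> \<W> t \<omega> = arr N (fst (\<omega> t)) (fqla_policy N \<sigma> \<W> t \<omega>)"

definition fqla_admitted ::
  "('s, 'x, 'r::finite) network \<Rightarrow> (real ^ 'r \<Rightarrow> 's \<Rightarrow> 'x) \<Rightarrow> real ^ 'r \<Rightarrow> nat \<Rightarrow>
     (nat \<Rightarrow> 's \<times> real) \<Rightarrow> real ^ 'r" where
  "fqla_admitted N \<sigma> \<W> t \<omega> =
     (\<chi> j. let w = qla_backlog N \<sigma> \<W> t \<omega> $ j; a = fqla_arr N \<sigma> \<W> t \<omega> $ j
           in if w \<ge> \<W> $ j then a else max (a - \<W> $ j + w) 0)"

primrec fqla_backlog ::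
  "('s, 'x, 'r::finite) network \<Rightarrow> (real ^ 'r \<Rightarrow> 's \<Rightarrow> 'x) \<Rightarrow> real ^ 'r \<Rightarrow> nat \<Rightarrow>
     (nat \<Rightarrow> 's \<times> real) \<Rightarrow> real ^ 'r" where
  "fqla_backlog N \<sigma> \<W> 0 \<omega> = 0"
| "fqla_backlog N \<sigma> \<W> (Suc t) \<omega> =
     queue_update (fqla_backlog N \<sigma> \<W> t \<omega>)
       (srv N (fst (\<omega> t)) (fqla_policy N \<sigma> \<W> t \<omega>)) (fqla_admitted N \<sigma> \<W> t \<omega>)"

definition fqla_avg_backlog ::
  "('s, 'x, 'r::finite) network \<Rightarrow> (real ^ 'r \<Rightarrow> 's \<Rightarrow> 'x) \<Rightarrow> real ^ 'r \<Rightarrow> ereal" where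
  "fqla_avg_backlog N \<sigma> \<W> = tavg (\<lambda>t. \<Sum>j\<in>UNIV. expect N (\<lambda>\<omega>. fqla_backlog N \<sigma> \<W> t \<omega> $ j))"

definition total_arrivals ::
  "('s, 'x, 'r::finite) network \<Rightarrow> (real ^ 'r \<Rightarrow> 's \<Rightarrow> 'x) \<Rightarrow> real ^ 'r \<Rightarrow> nat \<Rightarrow> real" where
  "total_arrivals N \<sigma> \<W> t =
     (\<Sum>\<tau><t. \<Sum>j\<in>UNIV. expect N (\<lambda>\<omega>. fqla_arr N \<sigma> \<W> \<tau> \<omega> $ j))"

definition total_dropped ::
  "('s, 'x, 'r::finite) network \<Rightarrow> (real ^ 'r \<Rightarrow> 's \<Rightarrow> 'x) \<Rightarrow> real ^ 'r \<Rightarrow> nat \<Rightarrow> real" where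
  "total_dropped N \<sigma> \<W> t =
     (\<Sum>\<tau><t. \<Sum>j\<in>UNIV.
        expect N (\<lambda>\<omega>. fqla_arr N \<sigma> \<W> \<tau> \<omega> $ j - fqla_admitted N \<sigma> \<W> \<tau> \<omega> $ j))"

definition drop_fraction ::
  "('s, 'x, 'r::finite) network \<Rightarrow> (real ^ 'r \<Rightarrow> 's \<Rightarrow> 'x) \<Rightarrow> real ^ 'r \<Rightarrow> ereal" where
  "drop_fraction N \<sigma> \<W> =
     limsup (\<lambda>t. ereal (total_dropped N \<sigma> \<W> t / total_arrivals N \<sigma> \<W> t))"

text \<open>
  The bound on the drop fraction is claimed only if the expected total number of arrivals over
  the infinite horizon is infinite, so that the long-run ratio is not determined by the initial
  transient. Otherwise the bound can fail: if the chain \<open>W\<close> is absorbed at the dual maximizer,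
  where all actions are idle, both totals converge, and the drops of the first few slots alone
  make the ratio of the limits of the order of the reciprocal of \<open>(ln V)\<^sup>2 * sqrt V\<close>.
\<close>

definition fqla_performance ::
  "('s, 'x, 'r::finite) network \<Rightarrow> (real ^ 'r \<Rightarrow> 's \<Rightarrow> 'x) \<Rightarrow> real \<Rightarrow> real \<Rightarrow> real \<Rightarrow>
     real ^ 'r \<Rightarrow> bool" where
  "fqla_performance N \<sigma> C c0 V \<W> \<longleftrightarrow>
     \<bar>avg_cost N (fqla_policy N \<sigma> \<W>) - opt_cost N\<bar> \<le> ereal (C / V) \<and>
     fqla_avg_backlog N \<sigma> \<W> \<le> ereal (C * ((ln V)\<^sup>2 * sqrt V)) \<and>
     (filterlim (total_arrivals N \<sigma> \<W>) at_top sequentially \<longrightarrow>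
        drop_fraction N \<sigma> \<W> \<le> ereal (C * (1 / V powr (c0 * ln V))))"

end

theory Submission
  imports Defs
begin

text \<open>
  QLA and FQLA are both governed by the backlog chain \<open>W\<close> of QLA, started from a nonnegative vector.
  Expectations along this chain are iterates of a one-step averaging operator
  (\<open>expect_qla\<close>), so their asymptotics reduce to a one-step drift inequality that is summed
  over time (\<open>drift_sum\<close>) or contracted (\<open>contraction\<close>).

  QLA minimises the Lagrangian at the current backlog, so \<open>V\<close> times the cost
  plus the drift of half the squared norm of \<open>W\<close> is at most a constant plus the optimal dual value (\<open>cost_sum\<close>).
  Conversely, a stable policy has bounded expected backlog at infinitely many times. At such times its arrivals
  exceed its services only by a constant, so its average cost is at least the dual optimum over \<open>V\<close>
  (\<open>weak_duality\<close>). The optimal cost lies between these two bounds, which differ by a multiple of \<open>1 / V\<close>.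

  By scaling, the dual function for \<open>V\<close> has its maximizer at \<open>u = V *\<^sub>R dual_opt N 1\<close> and
  falls off there like \<open>L / V\<close> times the squared distance; concavity turns this into a linear fall-off
  beyond distance of order \<open>sqrt V\<close> (\<open>dual_gap\<close>). Since the dual gap is the drift of the chain towards \<open>u\<close>,
  the distance \<open>R\<close> to \<open>u\<close> has drift of order \<open>- 1 / sqrt V\<close> outside a ball of radius of order \<open>sqrt V\<close>. With bounded
  increments, \<open>F = exp (\<theta> * R)\<close> for \<open>\<theta>\<close> of order \<open>1 / sqrt V\<close> shrinks by a factor \<open>1 - \<kappa> / V\<close> outside the ball
  (\<open>exp_drift_far\<close>), so the long-run probability of being at distance \<open>(ln V)\<^sup>2 * sqrt V\<close> from \<open>u\<close> is of order \<open>V\<close> times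
  \<open>exp (- a * (ln V)\<^sup>2)\<close>, which is superpolynomially small.

  Pathwise, the real queues of FQLA exceed the part of \<open>W\<close> above the threshold by at most
  a constant (\<open>fqla_backlog_le\<close>), and packets are dropped only while \<open>W\<close> is below the threshold in some
  coordinate, hence far from \<open>u\<close>. The drop fraction compares two quantities that may both be much smaller than the
  number of slots, so bounding the drops per slot would not suffice. Instead, near \<open>u\<close> the increase of \<open>F\<close> is bounded by the traffic
  of the slot (\<open>exp_drift_near\<close>): excursions have to be paid for by packets, which bounds the number of far
  visits by a small multiple of the total arrivals (\<open>far_visits\<close>, \<open>traffic_sum\<close>).

  All of this holds for the threshold derived from any vector within half the margin \<open>(ln V)\<^sup>2 * sqrt V\<close> of \<open>u\<close>
  (\<open>performance_near\<close>). For FQLA-Ideal that vector is \<open>u\<close> itself; for FQLA-General it is \<open>W(T)\<close>, which lies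
  within this range with high probability by the exponential moment bound (\<open>margin_concentration\<close>).
\<close>

section \<open>Functions of the state history\<close>

text \<open>
  The random variables of QLA and FQLA depend only on the states of finitely many slots. As there
  are finitely many states, such functions are measurable and bounded even for an arbitrary tie-breaking
  selection \<open>\<sigma>\<close>.
\<close>

definition determined :: "nat \<Rightarrow> ((nat \<Rightarrow> 's \<times> real) \<Rightarrow> 'b) \<Rightarrow> bool" where
  "determined t g \<longleftrightarrow> (\<forall>\<omega> \<omega>'. (\<forall>i<t. fst (\<omega> i) = fst (\<omega>' i)) \<longrightarrow> g \<omega> = g \<omega>')"

abbreviation slot :: "('s, 'x, 'r::finite) network \<Rightarrow> ('s \<times> real) measure" where
  "slot N \<equiv> measure_pmf (law N) \<Otimes>\<^sub>M uniform_measure lborel {0..1}"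

lemma prob_space_slot: "prob_space (slot N)"
  by (intro prob_space_pair prob_space_uniform_measure measure_pmf.prob_space_axioms) auto

lemma prob_space_sample: "prob_space (sample N)"
  unfolding sample_def by (intro prob_space_PiM prob_space_slot)

lemma space_sample [simp]: "space (sample N) = UNIV"
  by (simp add: sample_def space_PiM space_pair_measure PiE_UNIV_domain)

lemma measurable_state [measurable]:
  "(\<lambda>\<omega>. fst (\<omega> i)) \<in> sample N \<rightarrow>\<^sub>M count_space UNIV"
proof -
  have "(\<lambda>\<omega>. \<omega> i) \<in> sample N \<rightarrow>\<^sub>M slot N"
    unfolding sample_def by (rule measurable_component_singleton) simp
  moreover have "fst \<in> slot N \<rightarrow>\<^sub>M measure_pmf (law N)" by (rule measurable_fst)
  ultimately have "(\<lambda>\<omega>. fst (\<omega> i)) \<in> sample N \<rightarrow>\<^sub>M measure_pmf (law N)"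
    by (rule measurable_compose)
  thus ?thesis by (simp cong: measurable_cong_sets)
qed

definition history :: "nat \<Rightarrow> (nat \<Rightarrow> 's \<times> real) \<Rightarrow> 's list" where
  "history t \<omega> = map (\<lambda>i. fst (\<omega> i)) [0..<t]"

lemma measurable_history:
  "history t \<in> sample (N :: ('s::finite, 'x, 'r::finite) network) \<rightarrow>\<^sub>M count_space UNIV"
proof (induction t)
  case 0 show ?case unfolding history_def by simp
next
  case (Suc t)
  have "history (Suc t) = (\<lambda>\<omega>::nat \<Rightarrow> 's \<times> real. history t \<omega> @ [fst (\<omega> t)])"
    by (auto simp: history_def fun_eq_iff)
  moreover have "(\<lambda>\<omega>. (\<lambda>h \<omega>. (\<lambda>s \<omega>. h @ [s]) (fst (\<omega> t)) \<omega>) (history t \<omega>) \<omega>)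
      \<in> sample N \<rightarrow>\<^sub>M count_space UNIV"
    by (rule measurable_compose_countable[OF _ Suc],
        rule measurable_compose_countable[OF _ measurable_state]) simp
  ultimately show ?case by simp
qed

lemma determined_factor:
  assumes "determined t g"
  shows "g = (\<lambda>\<omega>. g (\<lambda>i. (history t \<omega> ! i, 0)))"
  using assms unfolding determined_def history_def by (auto simp: fun_eq_iff)

lemma measurable_determined:
  fixes N :: "('s::finite, 'x, 'r::finite) network"
  assumes "determined t g" "\<And>\<omega>. g \<omega> \<in> space M"
  shows "g \<in> sample N \<rightarrow>\<^sub>M M"
  by (subst determined_factor[OF assms(1)], rule measurable_compose[OF measurable_history])
     (use assms(2) in simp)

lemma finite_range_determined:
  fixes g :: "(nat \<Rightarrow> 's::finite \<times> real) \<Rightarrow> 'b"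
  assumes "determined t g"
  shows "finite (range g)"
proof -
  have "range (history t :: (nat \<Rightarrow> 's \<times> real) \<Rightarrow> 's list) \<subseteq> {xs. set xs \<subseteq> UNIV \<and> length xs = t}"
    by (auto simp: history_def)
  hence "finite (range (history t :: (nat \<Rightarrow> 's \<times> real) \<Rightarrow> 's list))"
    by (rule finite_subset) (intro finite_lists_length_eq finite)
  hence "finite ((\<lambda>xs. g (\<lambda>i. (xs ! i, 0))) ` range (history t :: (nat \<Rightarrow> 's \<times> real) \<Rightarrow> 's list))"
    by (rule finite_imageI)
  moreover have "range g \<subseteq> (\<lambda>xs. g (\<lambda>i. (xs ! i, 0))) ` range (history t)"
    by (subst determined_factor[OF assms]) auto
  ultimately show ?thesis by (rule finite_subset[rotated])
qed

lemma integrable_determined: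
  fixes N :: "('s::finite, 'x, 'r::finite) network" and g :: "_ \<Rightarrow> real"
  assumes "determined t g"
  shows "integrable (sample N) g"
proof -
  interpret prob_space "sample N" by (rule prob_space_sample)
  have "finite (range (\<lambda>\<omega>. norm (g \<omega>)))"
    using finite_imageI[OF finite_range_determined[OF assms], of norm] by (simp add: image_image)
  hence "\<forall>\<omega>. norm (g \<omega>) \<le> Max (range (\<lambda>\<omega>. norm (g \<omega>)))" by (auto intro: Max_ge)
  thus ?thesis
    by (intro integrable_const_bound[where B="Max (range (\<lambda>\<omega>. norm (g \<omega>)))"])
       (auto intro: measurable_determined[OF assms])
qed

lemma determined_comp: "determined t g \<Longrightarrow> determined t (\<lambda>\<omega>. h (g \<omega>))"
  unfolding determined_def by metis

definition mean :: "('s::finite, 'x, 'r::finite) network \<Rightarrow> ('s \<Rightarrow> real) \<Rightarrow> real" where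
  "mean N h = (\<Sum>s\<in>UNIV. pmf (law N) s * h s)"

lemma mean_mono: "(\<And>s. h s \<le> g s) \<Longrightarrow> mean N h \<le> mean N g"
  unfolding mean_def by (intro sum_mono mult_left_mono) auto

lemma mean_const [simp]: "mean N (\<lambda>_. c) = c"
  unfolding mean_def sum_distrib_right[symmetric] by (simp add: sum_pmf_eq_1)

lemma mean_add: "mean N (\<lambda>s. h s + g s) = mean N h + mean N g"
  by (simp add: mean_def algebra_simps sum.distrib)

lemma mean_cmult: "mean N (\<lambda>s. c * h s) = c * mean N h"
  by (simp add: mean_def sum_distrib_left algebra_simps)

lemma mean_diff: "mean N (\<lambda>s. h s - g s) = mean N h - mean N g"
  by (simp add: mean_def algebra_simps sum_subtractf)

lemma mean_sum: "mean N (\<lambda>s. \<Sum>j\<in>J. h j s) = (\<Sum>j\<in>J. mean N (h j))"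
  unfolding mean_def sum_distrib_left by (rule sum.swap)

text \<open>
  Conditioning on the first slot: the sample space is isomorphic to the product of one slot with a copy
  of itself, and under this isomorphism prepending a slot to the sequence is measure preserving.
\<close>

lemma expect_first_state:
  fixes N :: "('s::finite, 'x, 'r::finite) network"
  assumes "determined t g"
  shows "expect N g = mean N (\<lambda>s. expect N (\<lambda>\<omega>. g (case_nat (s, 0) \<omega>)))"
proof -
  interpret M: prob_space "slot N" by (rule prob_space_slot)
  interpret U: prob_space "uniform_measure lborel {0..1::real}"
    by (rule prob_space_uniform_measure) auto
  interpret seq: sequence_space "slot N" by unfold_locales
  interpret S: prob_space "sample N" by (rule prob_space_sample)
  interpret MS: pair_prob_space "slot N" "sample N" ..
  define G where "G s = expect N (\<lambda>\<omega>. g (case_nat (s, 0) \<omega>))" for s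
  \<comment> \<open>The uniform coordinate of the first slot does not influence \<open>g\<close>.\<close>
  have G: "expect N (\<lambda>\<omega>. g (case_nat x \<omega>)) = G (fst x)" for x
    unfolding G_def
  proof (rule Bochner_Integration.integral_cong[OF refl])
    fix \<omega> show "g (case_nat x \<omega>) = g (case_nat (fst x, 0) \<omega>)"
      using assms unfolding determined_def by (auto split: nat.split)
  qed
  have gm: "g \<in> borel_measurable (sample N)"
    by (rule measurable_determined[OF assms]) simp
  have cm: "(\<lambda>(x, \<omega>). case_nat x \<omega>) \<in> slot N \<Otimes>\<^sub>M sample N \<rightarrow>\<^sub>M sample N"
    unfolding sample_def by measurable
  have it: "distr (slot N \<Otimes>\<^sub>M sample N) (sample N) (\<lambda>(x, \<omega>). case_nat x \<omega>) = sample N"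
    using seq.PiM_iter by (simp add: sample_def)
  have int: "integrable (slot N \<Otimes>\<^sub>M sample N) (\<lambda>(x, \<omega>). g (case_nat x \<omega>))"
    using integrable_distr[OF cm, of g] integrable_determined[OF assms, of N]
    by (simp add: it[unfolded case_prod_beta'] case_prod_beta')
  have "expect N g = (\<integral>z. g (case_prod case_nat z) \<partial>(slot N \<Otimes>\<^sub>M sample N))"
    by (subst it[symmetric], subst integral_distr[OF cm gm]) (simp add: case_prod_beta')
  also have "\<dots> = (\<integral>x. expect N (\<lambda>\<omega>. g (case_nat x \<omega>)) \<partial>slot N)"
    using MS.integral_fst'[of "\<lambda>z. g (case_prod case_nat z)"] int by (simp add: case_prod_beta')
  also have "\<dots> = (\<integral>x. G (fst x) \<partial>slot N)" by (simp only: G)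
  also have "\<dots> = (\<integral>s. G s \<partial>distr (slot N) (measure_pmf (law N)) fst)"
    by (subst integral_distr) auto
  also have "distr (slot N) (measure_pmf (law N)) fst = measure_pmf (law N)"
    by (rule U.distr_pair_fst)
  also have "(\<integral>s. G s \<partial>measure_pmf (law N)) = mean N G"
    by (subst integral_measure_pmf_real[where A=UNIV]) (auto simp: mean_def mult.commute)
  finally show ?thesis by (simp add: G_def[abs_def])
qed

section \<open>Expectations along the backlog chain\<close>

definition nonneg :: "real ^ 'r::finite \<Rightarrow> bool" where
  "nonneg w \<longleftrightarrow> (\<forall>j. 0 \<le> w $ j)"

definition step ::
  "('s, 'x, 'r::finite) network \<Rightarrow> (real ^ 'r \<Rightarrow> 's \<Rightarrow> 'x) \<Rightarrow> real ^ 'r \<Rightarrow> 's \<Rightarrow> real ^ 'r" where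
  "step N \<sigma> w s = queue_update w (srv N s (\<sigma> w s)) (arr N s (\<sigma> w s))"

text \<open>
  \<open>transition N \<sigma> t h w\<close> is the expectation of \<open>h\<close> at the backlog reached from \<open>w\<close> after \<open>t\<close> slots,
  expressed by iterating the one-step averaging operator; it involves no measure theory, only
  finite sums.
\<close>

definition transition ::
  "('s::finite, 'x, 'r::finite) network \<Rightarrow> (real ^ 'r \<Rightarrow> 's \<Rightarrow> 'x) \<Rightarrow> nat \<Rightarrow>
     (real ^ 'r \<Rightarrow> real) \<Rightarrow> real ^ 'r \<Rightarrow> real" where
  "transition N \<sigma> t = ((\<lambda>h w. mean N (\<lambda>s. h (step N \<sigma> w s))) ^^ t)"

lemma transition_0 [simp]: "transition N \<sigma> 0 h w = h w"
  by (simp add: transition_def)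

lemma transition_Suc:
  "transition N \<sigma> (Suc t) h w = mean N (\<lambda>s. transition N \<sigma> t h (step N \<sigma> w s))"
  by (simp add: transition_def)

lemma transition_Suc':
  "transition N \<sigma> (Suc t) h w = transition N \<sigma> t (\<lambda>w. mean N (\<lambda>s. h (step N \<sigma> w s))) w"
  by (simp add: transition_def funpow_Suc_right del: funpow.simps)

lemma transition_const [simp]: "transition N \<sigma> t (\<lambda>_. c) w = c"
  by (induction t arbitrary: w) (simp_all add: transition_Suc)

lemma transition_add:
  "transition N \<sigma> t (\<lambda>w. h w + g w) w = transition N \<sigma> t h w + transition N \<sigma> t g w"
  by (induction t arbitrary: w) (simp_all add: transition_Suc mean_add)

lemma transition_cmult:
  "transition N \<sigma> t (\<lambda>w. c * h w) w = c * transition N \<sigma> t h w"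
  by (induction t arbitrary: w) (simp_all add: transition_Suc mean_cmult)

lemma transition_sum:
  "finite J \<Longrightarrow> transition N \<sigma> t (\<lambda>w. \<Sum>j\<in>J. h j w) w = (\<Sum>j\<in>J. transition N \<sigma> t (h j) w)"
  by (induction J rule: finite_induct) (simp_all add: transition_add)

lemma qla_backlog_shift:
  "qla_backlog N \<sigma> w (Suc t) (case_nat (s, v) \<omega>) = qla_backlog N \<sigma> (step N \<sigma> w s) t \<omega>"
proof (induction t)
  case 0 show ?case by (simp add: step_def Let_def)
next
  case (Suc t)
  show ?case by (subst qla_backlog.simps(2), subst Suc) simp
qed

lemma qla_backlog_cong:
  "\<forall>i<t. fst (\<omega> i) = fst (\<omega>' i) \<Longrightarrow> qla_backlog N \<sigma> w t \<omega> = qla_backlog N \<sigma> w t \<omega>'"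
  by (induction t) (simp_all add: Let_def)

lemma determined_qla_backlog: "determined t (\<lambda>\<omega>. qla_backlog N \<sigma> \<W> t \<omega>)"
  unfolding determined_def using qla_backlog_cong by blast

lemma determined_qla:
  "determined (Suc t) (\<lambda>\<omega>. h (qla_backlog N \<sigma> w t \<omega>) (fst (\<omega> t)))"
  unfolding determined_def
proof (intro allI impI)
  fix \<omega> \<omega>' :: "nat \<Rightarrow> 'a \<times> real"
  assume *: "\<forall>i<Suc t. fst (\<omega> i) = fst (\<omega>' i)"
  hence "qla_backlog N \<sigma> w t \<omega> = qla_backlog N \<sigma> w t \<omega>'"
    by (intro qla_backlog_cong) simp
  thus "h (qla_backlog N \<sigma> w t \<omega>) (fst (\<omega> t)) = h (qla_backlog N \<sigma> w t \<omega>') (fst (\<omega>' t))"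
    using * by simp
qed

text \<open>
  The Markov property, by induction on \<open>t\<close> over all initial backlogs: after the first slot the process
  is the same chain, driven by the shifted sequence.
\<close>

lemma expect_qla:
  "expect N (\<lambda>\<omega>. h (qla_backlog N \<sigma> w t \<omega>) (fst (\<omega> t))) = transition N \<sigma> t (\<lambda>w. mean N (h w)) w"
proof (induction t arbitrary: w)
  case 0
  interpret prob_space "sample N" by (rule prob_space_sample)
  have "prob UNIV = 1" using prob_space by simp
  thus ?case
    by (subst expect_first_state[OF determined_qla]) simp
next
  case (Suc t)
  show ?case
    by (subst expect_first_state[OF determined_qla], subst qla_backlog_shift)
       (simp add: Suc transition_Suc)
qed

lemma expect_qla_backlog:
  "expect N (\<lambda>\<omega>. h (qla_backlog N \<sigma> w t \<omega>)) = transition N \<sigma> t h w"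
  using expect_qla[of N "\<lambda>w _. h w" \<sigma> w t] by simp

lemma expect_state: "expect N (\<lambda>\<omega>. h (fst (\<omega> t))) = mean N h"
  using expect_qla[of N "\<lambda>_. h"] by simp

section \<open>Time averages\<close>

lemma limsup_ratio_le:
  fixes d A :: "nat \<Rightarrow> real"
  assumes A: "filterlim A at_top sequentially" and le: "\<And>t. d t \<le> c + b * A t"
  shows "limsup (\<lambda>t. ereal (d t / A t)) \<le> ereal b"
proof -
  have "((\<lambda>t. c / A t) \<longlongrightarrow> 0) sequentially"
    using A by (intro real_tendsto_divide_at_top[of _ c]) auto
  hence "((\<lambda>t. c / A t + b) \<longlongrightarrow> b) sequentially" by (auto intro: tendsto_eq_intros)
  hence lim: "((\<lambda>t. ereal (c / A t + b)) \<longlongrightarrow> ereal b) sequentially" by simp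
  have "\<forall>\<^sub>F t in sequentially. A t > 0"
    using A by (simp add: filterlim_at_top_dense)
  hence "\<forall>\<^sub>F t in sequentially. ereal (d t / A t) \<le> ereal (c / A t + b)"
  proof eventually_elim
    case (elim t)
    have "d t / A t \<le> (c + b * A t) / A t" using le[of t] elim by (intro divide_right_mono) auto
    also have "\<dots> = c / A t + b" using elim by (simp add: field_simps)
    finally show ?case by simp
  qed
  hence "limsup (\<lambda>t. ereal (d t / A t)) \<le> limsup (\<lambda>t. ereal (c / A t + b))"
    by (rule Limsup_mono)
  also have "\<dots> = ereal b" by (rule lim_imp_Limsup[OF _ lim]) simp
  finally show ?thesis .
qed

lemma tavg_le:
  assumes "\<And>t. (\<Sum>\<tau><t. h \<tau>) \<le> c + b * real t"
  shows "tavg h \<le> ereal b"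
  unfolding tavg_def using limsup_ratio_le[OF filterlim_real_sequentially assms] by simp

text \<open>
  As \<open>tavg\<close> is an upper limit, a lower bound at infinitely many times suffices. Weak duality relies on
  this, since stability controls the expected backlog at infinitely many times.
\<close>

lemma tavg_ge:
  assumes "\<exists>\<^sub>F t in sequentially. b * real t - c \<le> (\<Sum>\<tau><t. h \<tau>)"
  shows "ereal b \<le> tavg h"
proof (rule ccontr)
  assume "\<not> ereal b \<le> tavg h"
  hence "tavg h < ereal b" by simp
  then obtain x where x: "tavg h < ereal x" "ereal x < ereal b"
    using ereal_dense2 by blast
  have "\<forall>\<^sub>F t in sequentially. (1 / real t) * (\<Sum>\<tau><t. h \<tau>) < x"
    using Limsup_lessD[OF x(1)[unfolded tavg_def]] by simp
  moreover have "\<forall>\<^sub>F t in sequentially. c / (b - x) + 1 \<le> real t"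
    using filterlim_real_sequentially by (simp add: filterlim_at_top)
  moreover have "\<forall>\<^sub>F t in sequentially. t > (0::nat)" by (rule eventually_gt_at_top)
  ultimately have "\<forall>\<^sub>F t in sequentially. \<not> b * real t - c \<le> (\<Sum>\<tau><t. h \<tau>)"
  proof eventually_elim
    case (elim t)
    have "(\<Sum>\<tau><t. h \<tau>) < x * real t" using elim by (simp add: field_simps)
    moreover have "c < (b - x) * real t" using elim x(2) by (simp add: field_simps)
    ultimately show ?case by (simp add: algebra_simps)
  qed
  thus False using assms by (simp add: frequently_def)
qed

lemma tavg_finite_imp_frequently_bounded:
  assumes "tavg h < \<infinity>" and h0: "\<And>t. 0 \<le> h t"
  obtains C where "C \<ge> 0" "\<exists>\<^sub>F t in sequentially. h t \<le> C"
proof -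
  obtain x :: nat where x: "tavg h < ereal (real x)"
    using assms(1) less_PInf_Ex_of_nat[of "tavg h"] by auto
  have ev: "\<forall>\<^sub>F t in sequentially. (1 / real t) * (\<Sum>\<tau><t. h \<tau>) < real x"
    using Limsup_lessD[OF x[unfolded tavg_def]] by simp
  \<comment> \<open>If \<open>h\<close> were eventually above \<open>x + 1\<close>, its partial sums would outgrow \<open>x * t\<close>.\<close>
  have "\<exists>\<^sub>F t in sequentially. h t \<le> real x + 1"
  proof (rule ccontr)
    assume "\<not> (\<exists>\<^sub>F t in sequentially. h t \<le> real x + 1)"
    hence "\<forall>\<^sub>F t in sequentially. real x + 1 < h t" by (simp add: frequently_def not_le)
    then obtain t0 where t0: "\<And>t. t \<ge> t0 \<Longrightarrow> real x + 1 < h t"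
      by (auto simp: eventually_sequentially)
    have sum: "(real x + 1) * real t - (real x + 1) * real t0 \<le> (\<Sum>\<tau><t. h \<tau>)" for t
    proof (induction t)
      case 0 show ?case by simp
    next
      case (Suc t)
      show ?case
      proof (cases "t0 \<le> t")
        case True thus ?thesis using Suc t0[OF True] by (simp add: algebra_simps)
      next
        case False
        hence "(real x + 1) * real (Suc t) \<le> (real x + 1) * real t0" by (intro mult_left_mono) auto
        moreover have "0 \<le> (\<Sum>\<tau><Suc t. h \<tau>)" using h0 by (intro sum_nonneg) auto
        ultimately show ?thesis by linarith
      qed
    qed
    have "\<forall>\<^sub>F t in sequentially. t > nat \<lceil>(real x + 1) * real t0\<rceil>" by (rule eventually_gt_at_top)
    with ev have "\<forall>\<^sub>F t in sequentially. False"
    proof eventually_elim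
      case (elim t)
      hence "(\<Sum>\<tau><t. h \<tau>) < real x * real t" by (simp add: field_simps split: if_splits)
      moreover have "(real x + 1) * real t0 < real t" using elim by linarith
      ultimately show False using sum[of t] by (simp add: algebra_simps)
    qed
    thus False by simp
  qed
  thus ?thesis using that[of "real x + 1"] by simp
qed

lemma tavg_mono: "(\<And>t. h t \<le> g t) \<Longrightarrow> tavg h \<le> tavg g"
  unfolding tavg_def
  by (intro Limsup_mono always_eventually allI) (auto intro!: divide_right_mono sum_mono)

section \<open>Drift inequalities for QLA\<close>

text \<open>
  QLA with a fixed \<open>V\<close> in a network whose quantities are bounded by \<open>\<delta>\<close>. The constant \<open>\<Delta>\<close> bounds the
  length of a backlog increment and \<open>2 * B\<close> bounds the second-order term of the quadratic drift.
\<close>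

locale qla_chain =
  fixes N :: "('s::finite, 'x, 'r::finite) network"
    and \<sigma> :: "real ^ 'r \<Rightarrow> 's \<Rightarrow> 'x" and V \<delta> B \<Delta> :: real
  assumes B_def: "B = real CARD('r) * \<delta>\<^sup>2" and \<Delta>_def: "\<Delta> = real CARD('r) * \<delta>"
    and V: "V \<ge> 1" and \<delta>: "\<delta> > 0"
    and rule: "qla_rule N V \<sigma>"
    and bound_cost: "x \<in> acts N s \<Longrightarrow> \<bar>cost N s x\<bar> \<le> \<delta>"
    and bound_arr: "x \<in> acts N s \<Longrightarrow> 0 \<le> arr N s x $ j \<and> arr N s x $ j \<le> \<delta>"
    and bound_srv: "x \<in> acts N s \<Longrightarrow> 0 \<le> srv N s x $ j \<and> srv N s x $ j \<le> \<delta>"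
begin

abbreviation cst where "cst w s \<equiv> cost N s (\<sigma> w s)"

abbreviation ar where "ar w s \<equiv> arr N s (\<sigma> w s)"

abbreviation sr where "sr w s \<equiv> srv N s (\<sigma> w s)"

abbreviation nxt where "nxt w s \<equiv> step N \<sigma> w s"

lemma act: "nonneg w \<Longrightarrow> \<sigma> w s \<in> acts N s"
  using rule unfolding qla_rule_def nonneg_def by blast

lemma ar_bounds: "nonneg w \<Longrightarrow> 0 \<le> ar w s $ j" "nonneg w \<Longrightarrow> ar w s $ j \<le> \<delta>"
  and sr_bounds: "nonneg w \<Longrightarrow> 0 \<le> sr w s $ j" "nonneg w \<Longrightarrow> sr w s $ j \<le> \<delta>"
  using act bound_arr bound_srv by blast+

lemma nxt_nth: "nxt w s $ j = max (w $ j - sr w s $ j) 0 + ar w s $ j"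
  by (simp add: step_def queue_update_def)

lemma nonneg_nxt: "nonneg w \<Longrightarrow> nonneg (nxt w s)"
  using ar_bounds(1)[of w s] by (auto simp: nonneg_def nxt_nth intro!: add_nonneg_nonneg)

lemma nonneg_qla: "nonneg w \<Longrightarrow> nonneg (qla_backlog N \<sigma> w t \<omega>)"
  by (induction t) (simp_all add: Let_def nonneg_nxt[unfolded step_def])

lemma \<Delta>_pos: "\<Delta> > 0" using \<delta> by (simp add: \<Delta>_def)

lemma B_pos: "B > 0" using \<delta> by (simp add: B_def)

lemma transition_mono:
  assumes "\<And>w. nonneg w \<Longrightarrow> h w \<le> g w" "nonneg w"
  shows "transition N \<sigma> t h w \<le> transition N \<sigma> t g w"
  using assms(2)
  by (induction t arbitrary: w) (auto simp: transition_Suc assms(1) nonneg_nxt intro!: mean_mono)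

text \<open>
  The telescoping principle behind all long-run bounds: if \<open>h\<close> is a potential and in every slot \<open>g\<close> is paid for by
  \<open>k\<close> and the expected decrease of \<open>h\<close>, then up to the initial potential the sum of \<open>g\<close> is paid for by the sum of \<open>k\<close>.
\<close>

lemma drift_sum:
  assumes drift: "\<And>w. nonneg w \<Longrightarrow> g w + mean N (\<lambda>s. h (nxt w s)) \<le> h w + k w"
    and h0: "\<And>w. nonneg w \<Longrightarrow> 0 \<le> h w" and w: "nonneg w"
  shows "(\<Sum>\<tau><t. transition N \<sigma> \<tau> g w) \<le> h w + (\<Sum>\<tau><t. transition N \<sigma> \<tau> k w)"
proof -
  have "(\<Sum>\<tau><t. transition N \<sigma> \<tau> g w) + transition N \<sigma> t h w
      \<le> h w + (\<Sum>\<tau><t. transition N \<sigma> \<tau> k w)"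
  proof (induction t)
    case (Suc t)
    have "transition N \<sigma> t (\<lambda>w. g w + mean N (\<lambda>s. h (nxt w s))) w
        \<le> transition N \<sigma> t (\<lambda>w. h w + k w) w"
      by (rule transition_mono[OF drift w])
    hence "transition N \<sigma> t g w + transition N \<sigma> (Suc t) h w
        \<le> transition N \<sigma> t h w + transition N \<sigma> t k w"
      by (simp add: transition_add transition_Suc')
    with Suc show ?case by simp
  qed simp
  moreover have "transition N \<sigma> t (\<lambda>_. 0) w \<le> transition N \<sigma> t h w"
    by (rule transition_mono[OF h0 w])
  ultimately show ?thesis by simp
qed

lemma contraction:
  assumes drift: "\<And>w. nonneg w \<Longrightarrow> mean N (\<lambda>s. h (nxt w s)) \<le> (1 - \<gamma>) * h w + M"
    and \<gamma>: "0 < \<gamma>" "\<gamma> \<le> 1" and M: "0 \<le> M" and w: "nonneg w"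
  shows "transition N \<sigma> t h w \<le> (1 - \<gamma>) ^ t * h w + M / \<gamma>"
proof (induction t)
  case 0 show ?case using \<gamma> M by simp
next
  case (Suc t)
  have "transition N \<sigma> (Suc t) h w \<le> transition N \<sigma> t (\<lambda>w. (1 - \<gamma>) * h w + M) w"
    unfolding transition_Suc' by (rule transition_mono[OF drift w])
  also have "\<dots> = (1 - \<gamma>) * transition N \<sigma> t h w + M"
    by (simp add: transition_add transition_cmult)
  also have "\<dots> \<le> (1 - \<gamma>) * ((1 - \<gamma>) ^ t * h w + M / \<gamma>) + M"
    using Suc \<gamma> by (intro add_right_mono mult_left_mono) auto
  also have "\<dots> = (1 - \<gamma>) ^ Suc t * h w + M / \<gamma>"
    using \<gamma> by (simp add: field_simps)
  finally show ?case .
qed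

text \<open>
  The expected value, with multipliers \<open>w\<close>, of the Lagrangian at the action that QLA takes when the backlog is
  \<open>v\<close>. It is affine in \<open>w\<close> and, over nonnegative \<open>v\<close>, minimal at \<open>v = w\<close>, where it is the dual function.
\<close>

definition lagrangian where
  "lagrangian w v = mean N (\<lambda>s. V * cst v s + w \<bullet> (ar v s - sr v s))"

lemma lagrangian_min_state:
  assumes "nonneg w" "x \<in> acts N s"
  shows "V * cst w s + w \<bullet> (ar w s - sr w s) \<le> V * cost N s x + w \<bullet> (arr N s x - srv N s x)"
proof -
  have "qla_objective N V w s x \<le> qla_objective N V w s (\<sigma> w s)"
    using rule assms unfolding qla_rule_def nonneg_def by blast
  moreover have "(\<Sum>j\<in>UNIV. w $ j * (srv N s y $ j - arr N s y $ j)) = - (w \<bullet> (arr N s y - srv N s y))" for y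
    by (simp add: inner_vec_def sum_negf[symmetric] algebra_simps)
  ultimately show ?thesis by (simp add: qla_objective_def)
qed

lemma lagrangian_min: "nonneg w \<Longrightarrow> nonneg v \<Longrightarrow> lagrangian w w \<le> lagrangian w v"
  unfolding lagrangian_def by (intro mean_mono lagrangian_min_state act)

lemma lagrangian_affine:
  "lagrangian (\<alpha> *\<^sub>R w + (1 - \<alpha>) *\<^sub>R u) v = \<alpha> * lagrangian w v + (1 - \<alpha>) * lagrangian u v"
  unfolding lagrangian_def mean_cmult[symmetric] mean_add[symmetric]
  by (simp add: algebra_simps)

lemma lagrangian_diff: "lagrangian w v - lagrangian u v = mean N (\<lambda>s. (w - u) \<bullet> (ar v s - sr v s))"
  unfolding lagrangian_def mean_diff[symmetric] by (simp add: inner_diff_left)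

text \<open>
  Multiplying \<open>V\<close> and the multipliers by the same positive factor scales the Lagrangian, so the action
  of QLA attains the infimum in the dual function for every parameter \<open>V'\<close> along the ray through \<open>w\<close>.
\<close>

lemma dual_value:
  assumes w: "nonneg w" and V': "0 < V'"
  shows "dual N V' ((V' / V) *\<^sub>R w) = V' / V * lagrangian w w"
proof -
  let ?val = "\<lambda>\<xi>. \<Sum>s\<in>UNIV. pmf (law N) s * (V' * cost N s (\<xi> s) +
      (\<Sum>j\<in>UNIV. ((V' / V) *\<^sub>R w) $ j * (arr N s (\<xi> s) $ j - srv N s (\<xi> s) $ j)))"
  have val: "?val \<xi> = V' / V * mean N (\<lambda>s. V * cost N s (\<xi> s) + w \<bullet> (arr N s (\<xi> s) - srv N s (\<xi> s)))" for \<xi>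
    unfolding mean_def sum_distrib_left
    using V by (intro sum.cong) (auto simp: inner_vec_def algebra_simps sum_distrib_left sum_divide_distrib)
  have "dual N V' ((V' / V) *\<^sub>R w) = ?val (\<sigma> w)"
    unfolding dual_def
  proof (rule cInf_eq_minimum)
    show "?val (\<sigma> w) \<in> ?val ` {\<xi>. \<forall>s. \<xi> s \<in> acts N s}" using act[OF w] by blast
    fix v assume "v \<in> ?val ` {\<xi>. \<forall>s. \<xi> s \<in> acts N s}"
    then obtain \<xi> where v: "v = ?val \<xi>" and \<xi>: "\<And>s. \<xi> s \<in> acts N s" by auto
    show "?val (\<sigma> w) \<le> v"
      unfolding v val using V V' w \<xi>
      by (intro mult_left_mono mean_mono lagrangian_min_state) auto
  qed
  thus ?thesis unfolding val lagrangian_def by simp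
qed

lemma dual_eq_lagrangian: "nonneg w \<Longrightarrow> dual N V w = lagrangian w w"
  using dual_value[of w V] V by simp

lemma dual_scaled: "nonneg w \<Longrightarrow> dual N 1 ((1 / V) *\<^sub>R w) = lagrangian w w / V"
  using dual_value[of w 1] by simp

lemma dual_opt_scaled:
  assumes unique: "\<exists>!U. dual_maximizer N 1 U" "\<exists>!U. dual_maximizer N V U"
  defines "u \<equiv> V *\<^sub>R dual_opt N 1"
  shows "nonneg u" "nonneg w \<Longrightarrow> lagrangian w w \<le> lagrangian u u" "dual_opt N V = u"
proof -
  define u0 where "u0 = dual_opt N 1"
  have "dual_maximizer N 1 u0"
    unfolding u0_def dual_opt_def by (rule theI'[OF unique(1)])
  hence u0: "nonneg u0" "\<And>w. nonneg w \<Longrightarrow> dual N 1 w \<le> dual N 1 u0"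
    by (auto simp: dual_maximizer_def nonneg_def)
  have u: "u = V *\<^sub>R u0" by (simp add: u_def u0_def)
  show nn: "nonneg u" using u0(1) V by (simp add: u nonneg_def)
  have max: "lagrangian w w \<le> lagrangian u u" if w: "nonneg w" for w
  proof -
    have "nonneg ((1 / V) *\<^sub>R w)" using w V by (simp add: nonneg_def)
    from u0(2)[OF this] have "lagrangian w w / V \<le> dual N 1 u0" by (simp add: dual_scaled[OF w])
    also have "\<dots> = lagrangian u u / V" using dual_scaled[OF nn] V by (simp add: u)
    finally show ?thesis using V by (simp add: divide_le_cancel)
  qed
  thus "nonneg w \<Longrightarrow> lagrangian w w \<le> lagrangian u u" .
  have "dual_maximizer N V u"
    using nn max by (auto simp: dual_maximizer_def dual_eq_lagrangian nonneg_def[symmetric])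
  thus "dual_opt N V = u"
    unfolding dual_opt_def by (rule the1_equality[OF unique(2)])
qed

text \<open>
  Under the scaling by \<open>V\<close> the dual gap grows by the factor \<open>V\<close> and squared distances by \<open>V\<^sup>2\<close>, so the
  curvature constant \<open>L\<close> becomes \<open>L / V\<close>.
\<close>

lemma quadratic_growth:
  assumes unique: "\<exists>!U. dual_maximizer N 1 U" "\<exists>!U. dual_maximizer N V U"
    and smooth: "locally_smooth N \<epsilon> L"
    and w: "nonneg w" and near: "norm (w - V *\<^sub>R dual_opt N 1) < \<epsilon> * V"
  shows "lagrangian w w + L / V * (norm (w - V *\<^sub>R dual_opt N 1))\<^sup>2
    \<le> lagrangian (V *\<^sub>R dual_opt N 1) (V *\<^sub>R dual_opt N 1)"
proof -
  define u0 where "u0 = dual_opt N 1"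
  define w' where "w' = (1 / V) *\<^sub>R w"
  have w': "nonneg w'" using w V by (simp add: w'_def nonneg_def)
  have nn: "nonneg (V *\<^sub>R u0)" unfolding u0_def by (rule dual_opt_scaled(1)[OF unique])
  have "w - V *\<^sub>R u0 = V *\<^sub>R (w' - u0)" using V by (simp add: w'_def algebra_simps)
  hence norm: "norm (w - V *\<^sub>R u0) = V * norm (w' - u0)" using V by simp
  hence "norm (w' - u0) < \<epsilon>" using near V by (simp add: u0_def mult.commute)
  hence "dual N 1 w' + L * (norm (w' - u0))\<^sup>2 \<le> dual N 1 u0"
    using smooth w' unfolding locally_smooth_def u0_def nonneg_def by blast
  moreover have "dual N 1 w' = lagrangian w w / V" by (simp add: w'_def dual_scaled[OF w])
  moreover have "dual N 1 u0 = lagrangian (V *\<^sub>R u0) (V *\<^sub>R u0) / V"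
    using dual_scaled[OF nn] V by simp
  ultimately have "V * (lagrangian w w / V + L * (norm (w' - u0))\<^sup>2) \<le> V * (lagrangian (V *\<^sub>R u0) (V *\<^sub>R u0) / V)"
    using V by (intro mult_left_mono) auto
  thus ?thesis using V norm by (simp add: u0_def[symmetric] distrib_left power_mult_distrib power2_eq_square mult_ac)
qed

text \<open>
  Truncation at \<open>0\<close> only brings the backlog closer to the nonnegative \<open>u\<close>, and in the cross term with the
  arrivals the backlog after service may be replaced by the larger backlog \<open>w\<close> before service.
\<close>

lemma square_drift_coordinate:
  fixes w u a m :: real
  assumes "0 \<le> w" "0 \<le> u" "0 \<le> a" "0 \<le> m" "a \<le> \<delta>" "m \<le> \<delta>"
  shows "(max (w - m) 0 + a - u)\<^sup>2 \<le> (w - u)\<^sup>2 + 2 * ((w - u) * (a - m)) + 2 * \<delta>\<^sup>2"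
proof -
  define y where "y = max (w - m) 0"
  have "(y - u)\<^sup>2 \<le> (w - m - u)\<^sup>2"
    using assms by (intro abs_le_square_iff[THEN iffD1]) (auto simp: y_def)
  moreover have "a * (y - u) \<le> a * (w - u)"
    using assms by (intro mult_left_mono) (auto simp: y_def)
  moreover have "a\<^sup>2 \<le> \<delta>\<^sup>2" "m\<^sup>2 \<le> \<delta>\<^sup>2" using assms by (auto intro: power_mono)
  moreover have "(y + a - u)\<^sup>2 = (y - u)\<^sup>2 + 2 * (a * (y - u)) + a\<^sup>2"
    "(w - m - u)\<^sup>2 = (w - u)\<^sup>2 - 2 * (m * (w - u)) + m\<^sup>2"
    "(w - u) * (a - m) = a * (w - u) - m * (w - u)"
    by (simp_all add: power2_eq_square algebra_simps)
  ultimately show ?thesis unfolding y_def[symmetric] by linarith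
qed

lemma square_drift_state:
  assumes w: "nonneg w" and u: "nonneg u"
  shows "(norm (nxt w s - u))\<^sup>2 \<le> (norm (w - u))\<^sup>2 + 2 * ((w - u) \<bullet> (ar w s - sr w s)) + 2 * B"
proof -
  have "(norm (nxt w s - u))\<^sup>2 = (\<Sum>j\<in>UNIV. (nxt w s $ j - u $ j)\<^sup>2)"
    unfolding power2_norm_eq_inner inner_vec_def by (simp add: power2_eq_square)
  also have "\<dots> \<le> (\<Sum>j\<in>UNIV. (w $ j - u $ j)\<^sup>2
      + 2 * ((w $ j - u $ j) * (ar w s $ j - sr w s $ j)) + 2 * \<delta>\<^sup>2)"
    unfolding nxt_nth using w u ar_bounds[OF w] sr_bounds[OF w]
    by (intro sum_mono square_drift_coordinate) (auto simp: nonneg_def)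
  also have "\<dots> = (norm (w - u))\<^sup>2 + 2 * ((w - u) \<bullet> (ar w s - sr w s)) + 2 * B"
    unfolding power2_norm_eq_inner inner_vec_def
    by (simp add: power2_eq_square sum.distrib B_def sum_distrib_left)
  finally show ?thesis .
qed

text \<open>
  The mean increment of the queues before truncation is a supergradient of the dual function at \<open>w\<close>, so
  up to the noise \<open>2 * B\<close> the squared distance to \<open>u\<close> drifts down by at least twice the amount by which the
  dual value at \<open>u\<close> exceeds that at \<open>w\<close>.
\<close>

lemma square_drift:
  assumes w: "nonneg w" and u: "nonneg u"
  shows "mean N (\<lambda>s. (norm (nxt w s - u))\<^sup>2)
      \<le> (norm (w - u))\<^sup>2 + 2 * B - 2 * (lagrangian u u - lagrangian w w)"
proof -
  have "mean N (\<lambda>s. (norm (nxt w s - u))\<^sup>2)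
      \<le> mean N (\<lambda>s. ((norm (w - u))\<^sup>2 + 2 * B) + 2 * ((w - u) \<bullet> (ar w s - sr w s)))"
    using square_drift_state[OF w u] by (intro mean_mono) (simp add: algebra_simps)
  also have "\<dots> = (norm (w - u))\<^sup>2 + 2 * B + 2 * (lagrangian w w - lagrangian u w)"
    by (subst mean_add) (simp add: mean_cmult lagrangian_diff)
  also have "\<dots> \<le> (norm (w - u))\<^sup>2 + 2 * B - 2 * (lagrangian u u - lagrangian w w)"
    using lagrangian_min[OF u w] by simp
  finally show ?thesis .
qed

text \<open>
  Drift plus penalty: the drift bound with \<open>u = 0\<close>, to which \<open>V\<close> times the cost is added, has
  the dual value at the current backlog on its right-hand side.
\<close>

lemma cost_sum:
  assumes w: "nonneg w" and u: "\<And>w. nonneg w \<Longrightarrow> lagrangian w w \<le> q"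
  shows "V * (\<Sum>\<tau><t. transition N \<sigma> \<tau> (\<lambda>w. mean N (cst w)) w)
      \<le> (norm w)\<^sup>2 / 2 + real t * (B + q)"
proof -
  have "(\<Sum>\<tau><t. transition N \<sigma> \<tau> (\<lambda>w. V * mean N (cst w)) w)
      \<le> (norm w)\<^sup>2 / 2 + (\<Sum>\<tau><t. transition N \<sigma> \<tau> (\<lambda>w. B + q) w)"
  proof (rule drift_sum[OF _ _ w])
    fix w :: "real ^ 'r" assume w: "nonneg w"
    have "V * mean N (cst w) + mean N (\<lambda>s. (norm (nxt w s))\<^sup>2 / 2)
        = mean N (\<lambda>s. V * cst w s + (norm (nxt w s))\<^sup>2 / 2)"
      by (simp add: mean_add mean_cmult)
    also have "\<dots> \<le> mean N (\<lambda>s. (V * cst w s + w \<bullet> (ar w s - sr w s)) + ((norm w)\<^sup>2 / 2 + B))"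
    proof (rule mean_mono)
      fix s
      show "V * cst w s + (norm (nxt w s))\<^sup>2 / 2
          \<le> (V * cst w s + w \<bullet> (ar w s - sr w s)) + ((norm w)\<^sup>2 / 2 + B)"
        using square_drift_state[OF w, of 0 s] by (simp add: nonneg_def)
    qed
    also have "\<dots> = lagrangian w w + ((norm w)\<^sup>2 / 2 + B)"
      by (subst mean_add) (simp add: lagrangian_def)
    also have "\<dots> \<le> (norm w)\<^sup>2 / 2 + (B + q)" using u[OF w] by simp
    finally show "V * mean N (cst w) + mean N (\<lambda>s. (norm (nxt w s))\<^sup>2 / 2)
        \<le> (norm w)\<^sup>2 / 2 + (B + q)" .
  qed simp
  thus ?thesis by (simp add: transition_cmult sum_distrib_left)
qed

text \<open>
  The number of packets that enter or leave a queue in one slot; the effective service cannot exceed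
  the backlog.
\<close>

definition traffic where
  "traffic w s = (\<Sum>j\<in>UNIV. ar w s $ j + min (w $ j) (sr w s $ j))"

lemma norm_jump_traffic:
  assumes w: "nonneg w"
  shows "norm (nxt w s - w) \<le> traffic w s"
proof -
  have "norm (nxt w s - w) \<le> (\<Sum>j\<in>UNIV. \<bar>(nxt w s - w) $ j\<bar>)" by (rule norm_le_l1_cart)
  also have "\<dots> \<le> traffic w s"
    unfolding traffic_def
  proof (rule sum_mono)
    fix j
    show "\<bar>(nxt w s - w) $ j\<bar> \<le> ar w s $ j + min (w $ j) (sr w s $ j)"
      using w ar_bounds(1)[OF w, of s j] sr_bounds(1)[OF w, of s j]
      unfolding nonneg_def nxt_nth vector_minus_component by (smt (verit) min_def)
  qed
  finally show ?thesis .
qed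

lemma traffic_nonneg: "nonneg w \<Longrightarrow> 0 \<le> traffic w s"
  using norm_jump_traffic[of w s] norm_ge_zero[of "nxt w s - w"] by linarith

lemma norm_jump:
  assumes w: "nonneg w"
  shows "norm (nxt w s - w) \<le> \<Delta>"
proof -
  have "norm (nxt w s - w) \<le> (\<Sum>j\<in>UNIV. \<bar>(nxt w s - w) $ j\<bar>)" by (rule norm_le_l1_cart)
  also have "\<dots> \<le> (\<Sum>j\<in>(UNIV :: 'r set). \<delta>)"
  proof (rule sum_mono)
    fix j
    show "\<bar>(nxt w s - w) $ j\<bar> \<le> \<delta>"
      using w ar_bounds[OF w, of s j] sr_bounds[OF w, of s j]
      unfolding nonneg_def nxt_nth vector_minus_component by (smt (verit))
  qed
  finally show ?thesis by (simp add: \<Delta>_def)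
qed

lemma traffic_sum:
  assumes w: "nonneg w"
  shows "(\<Sum>\<tau><t. transition N \<sigma> \<tau> (\<lambda>w. mean N (traffic w)) w)
    \<le> (\<Sum>j\<in>UNIV. w $ j) + 2 * (\<Sum>\<tau><t. transition N \<sigma> \<tau> (\<lambda>w. mean N (\<lambda>s. \<Sum>j\<in>UNIV. ar w s $ j)) w)"
proof -
  have "(\<Sum>\<tau><t. transition N \<sigma> \<tau> (\<lambda>w. mean N (traffic w)) w)
      \<le> (\<Sum>j\<in>UNIV. w $ j)
        + (\<Sum>\<tau><t. transition N \<sigma> \<tau> (\<lambda>w. 2 * mean N (\<lambda>s. \<Sum>j\<in>UNIV. ar w s $ j)) w)"
  proof (rule drift_sum[OF _ _ w])
    fix w :: "real ^ 'r"
    assume "nonneg w"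
    \<comment> \<open>Conservation of packets: the effective service of a queue is
      \<open>min (w $ j) (sr w s $ j) = w $ j + ar w s $ j - nxt w s $ j\<close>.\<close>
    have "mean N (traffic w) + mean N (\<lambda>s. \<Sum>j\<in>UNIV. nxt w s $ j)
        = mean N (\<lambda>s. (\<Sum>j\<in>UNIV. w $ j) + 2 * (\<Sum>j\<in>UNIV. ar w s $ j))"
      unfolding mean_add[symmetric] traffic_def sum.distrib[symmetric] sum_distrib_left
      by (intro arg_cong[where f="mean N"] ext sum.cong) (auto simp: nxt_nth max_def min_def)
    thus "mean N (traffic w) + mean N (\<lambda>s. \<Sum>j\<in>UNIV. nxt w s $ j)
        \<le> (\<Sum>j\<in>UNIV. w $ j) + 2 * mean N (\<lambda>s. \<Sum>j\<in>UNIV. ar w s $ j)"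
      by (simp add: mean_add mean_cmult)
  next
    fix w :: "real ^ 'r"
    assume "nonneg w"
    thus "0 \<le> (\<Sum>j\<in>UNIV. w $ j)" by (intro sum_nonneg) (simp add: nonneg_def)
  qed
  thus ?thesis by (simp add: transition_cmult sum_distrib_left)
qed

section \<open>Weak duality for stable policies\<close>

lemma measurable_vec_nth: "f \<in> borel_measurable M \<Longrightarrow> (\<lambda>\<omega>. f \<omega> $ j) \<in> borel_measurable M"
  for f :: "_ \<Rightarrow> real ^ 'r::finite"
  using measurable_compose[of f M borel "\<lambda>v. v $ j" borel]
  by (simp add: borel_measurable_continuous_onI continuous_intros)

lemma backlog_nth_Suc:
  "backlog N \<phi> (Suc t) \<omega> $ j =
     max (backlog N \<phi> t \<omega> $ j - srv N (fst (\<omega> t)) (\<phi> t \<omega>) $ j) 0 + arr N (fst (\<omega> t)) (\<phi> t \<omega>) $ j"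
  by (simp add: queue_update_def)

context
  fixes \<phi> assumes \<phi>: "policy N \<phi>"
begin

abbreviation (input) c\<phi> where "c\<phi> t \<omega> \<equiv> cost N (fst (\<omega> t)) (\<phi> t \<omega>)"

abbreviation (input) a\<phi> where "a\<phi> t \<omega> \<equiv> arr N (fst (\<omega> t)) (\<phi> t \<omega>)"

abbreviation (input) s\<phi> where "s\<phi> t \<omega> \<equiv> srv N (fst (\<omega> t)) (\<phi> t \<omega>)"

lemma policy_acts: "\<phi> t \<omega> \<in> acts N (fst (\<omega> t))"
  using \<phi> by (auto simp: policy_def)

lemma policy_measurable:
  "c\<phi> t \<in> borel_measurable (sample N)" "a\<phi> t \<in> borel_measurable (sample N)"
  "s\<phi> t \<in> borel_measurable (sample N)"
  using \<phi> by (auto simp: policy_def)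

lemma policy_integrable:
  "integrable (sample N) (c\<phi> t)" "integrable (sample N) (\<lambda>\<omega>. a\<phi> t \<omega> $ j)"
  "integrable (sample N) (\<lambda>\<omega>. s\<phi> t \<omega> $ j)"
proof -
  interpret prob_space "sample N" by (rule prob_space_sample)
  show "integrable (sample N) (c\<phi> t)"
    by (rule integrable_const_bound[where B=\<delta>])
       (use bound_cost[OF policy_acts] policy_measurable in auto)
  show "integrable (sample N) (\<lambda>\<omega>. a\<phi> t \<omega> $ j)"
    by (rule integrable_const_bound[where B=\<delta>])
       (use bound_arr[OF policy_acts] measurable_vec_nth[OF policy_measurable(2)] in auto)
  show "integrable (sample N) (\<lambda>\<omega>. s\<phi> t \<omega> $ j)"
    by (rule integrable_const_bound[where B=\<delta>])
       (use bound_srv[OF policy_acts] measurable_vec_nth[OF policy_measurable(3)] in auto)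
qed

lemma policy_backlog_nonneg: "0 \<le> backlog N \<phi> t \<omega> $ j"
proof (cases t)
  case (Suc t')
  have "0 \<le> a\<phi> t' \<omega> $ j" using bound_arr[OF policy_acts[of t' \<omega>]] by blast
  thus ?thesis unfolding Suc backlog_nth_Suc by simp
qed simp

lemma policy_backlog_integrable: "integrable (sample N) (\<lambda>\<omega>. backlog N \<phi> t \<omega> $ j)"
proof (induction t)
  case (Suc t)
  show ?case unfolding backlog_nth_Suc
    using Suc policy_integrable
    by (intro Bochner_Integration.integrable_add Bochner_Integration.integrable_diff integrable_max) auto
qed simp

lemma policy_expect_backlog:
  "(\<Sum>\<tau><t. expect N (\<lambda>\<omega>. a\<phi> \<tau> \<omega> $ j) - expect N (\<lambda>\<omega>. s\<phi> \<tau> \<omega> $ j))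
     \<le> expect N (\<lambda>\<omega>. backlog N \<phi> t \<omega> $ j)"
proof (induction t)
  case (Suc t)
  have "expect N (\<lambda>\<omega>. backlog N \<phi> t \<omega> $ j + (a\<phi> t \<omega> $ j - s\<phi> t \<omega> $ j))
      \<le> expect N (\<lambda>\<omega>. backlog N \<phi> (Suc t) \<omega> $ j)"
    by (intro integral_mono Bochner_Integration.integrable_add Bochner_Integration.integrable_diff
        policy_integrable policy_backlog_integrable) (simp add: queue_update_def)
  moreover have "expect N (\<lambda>\<omega>. backlog N \<phi> t \<omega> $ j + (a\<phi> t \<omega> $ j - s\<phi> t \<omega> $ j))
      = expect N (\<lambda>\<omega>. backlog N \<phi> t \<omega> $ j)
        + (expect N (\<lambda>\<omega>. a\<phi> t \<omega> $ j) - expect N (\<lambda>\<omega>. s\<phi> t \<omega> $ j))"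
    using policy_integrable policy_backlog_integrable by simp
  ultimately show ?case using Suc by simp
qed simp

text \<open>
  The policy may depend on the whole past, but its action in state \<open>s\<close> is feasible for \<open>s\<close> and therefore has a
  Lagrangian no smaller than the minimum for \<open>s\<close>. This holds for every sample point, so only the law of the
  current state enters.
\<close>

lemma policy_lagrangian:
  assumes u: "nonneg u"
  shows "lagrangian u u \<le> V * expect N (c\<phi> t)
    + (\<Sum>j\<in>UNIV. u $ j * (expect N (\<lambda>\<omega>. a\<phi> t \<omega> $ j) - expect N (\<lambda>\<omega>. s\<phi> t \<omega> $ j)))"
proof -
  define g where "g s = V * cst u s + u \<bullet> (ar u s - sr u s)" for s
  have det: "determined (Suc t) (\<lambda>\<omega>. g (fst (\<omega> t)))" by (auto simp: determined_def)
  have "lagrangian u u = mean N g" by (simp add: lagrangian_def g_def[abs_def])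
  also have "\<dots> = expect N (\<lambda>\<omega>. g (fst (\<omega> t)))" by (rule expect_state[symmetric])
  also have "\<dots> \<le> expect N (\<lambda>\<omega>. V * c\<phi> t \<omega> + (\<Sum>j\<in>UNIV. u $ j * (a\<phi> t \<omega> $ j - s\<phi> t \<omega> $ j)))"
  proof (rule integral_mono[OF integrable_determined[OF det]])
    show "integrable (sample N) (\<lambda>\<omega>. V * c\<phi> t \<omega> + (\<Sum>j\<in>UNIV. u $ j * (a\<phi> t \<omega> $ j - s\<phi> t \<omega> $ j)))"
      using policy_integrable
      by (intro Bochner_Integration.integrable_add integrable_mult_right
          Bochner_Integration.integrable_sum Bochner_Integration.integrable_diff)
    fix \<omega>
    show "g (fst (\<omega> t)) \<le> V * c\<phi> t \<omega> + (\<Sum>j\<in>UNIV. u $ j * (a\<phi> t \<omega> $ j - s\<phi> t \<omega> $ j))"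
      using lagrangian_min_state[OF u policy_acts, of "\<omega>" t]
      unfolding g_def by (simp add: inner_vec_def)
  qed
  also have "\<dots> = V * expect N (c\<phi> t)
    + (\<Sum>j\<in>UNIV. u $ j * (expect N (\<lambda>\<omega>. a\<phi> t \<omega> $ j) - expect N (\<lambda>\<omega>. s\<phi> t \<omega> $ j)))"
    using policy_integrable by (simp add: Bochner_Integration.integral_add)
  finally show ?thesis .
qed

lemma weak_duality:
  assumes u: "nonneg u" and stable: "stable N \<phi>"
  shows "ereal (lagrangian u u / V) \<le> avg_cost N \<phi>"
proof -
  define b where "b t = (\<Sum>j\<in>UNIV. expect N (\<lambda>\<omega>. backlog N \<phi> t \<omega> $ j))" for t
  have eb: "0 \<le> expect N (\<lambda>\<omega>. backlog N \<phi> t \<omega> $ j)" for t j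
    using policy_backlog_nonneg by (intro Bochner_Integration.integral_nonneg) auto
  have b0: "0 \<le> b t" for t unfolding b_def by (intro sum_nonneg eb)
  have "tavg b < \<infinity>" using stable unfolding stable_def avg_backlog_def b_def .
  then obtain C where C: "C \<ge> 0" "\<exists>\<^sub>F t in sequentially. b t \<le> C"
    using tavg_finite_imp_frequently_bounded b0 by blast
  have sum: "lagrangian u u * real t \<le> V * (\<Sum>\<tau><t. expect N (c\<phi> \<tau>)) + norm u * b t" for t
  proof -
    have "lagrangian u u * real t = (\<Sum>\<tau><t. lagrangian u u)" by simp
    also have "\<dots> \<le> (\<Sum>\<tau><t. V * expect N (c\<phi> \<tau>)
        + (\<Sum>j\<in>UNIV. u $ j * (expect N (\<lambda>\<omega>. a\<phi> \<tau> \<omega> $ j) - expect N (\<lambda>\<omega>. s\<phi> \<tau> \<omega> $ j))))"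
      by (intro sum_mono policy_lagrangian u)
    also have "\<dots> = V * (\<Sum>\<tau><t. expect N (c\<phi> \<tau>))
        + (\<Sum>j\<in>UNIV. u $ j * (\<Sum>\<tau><t. expect N (\<lambda>\<omega>. a\<phi> \<tau> \<omega> $ j) - expect N (\<lambda>\<omega>. s\<phi> \<tau> \<omega> $ j)))"
      unfolding sum.distrib sum_distrib_left by (subst (2) sum.swap) simp
    also have "\<dots> \<le> V * (\<Sum>\<tau><t. expect N (c\<phi> \<tau>))
        + (\<Sum>j\<in>UNIV. norm u * expect N (\<lambda>\<omega>. backlog N \<phi> t \<omega> $ j))"
    proof (intro add_left_mono sum_mono)
      fix j
      have "u $ j * (\<Sum>\<tau><t. expect N (\<lambda>\<omega>. a\<phi> \<tau> \<omega> $ j) - expect N (\<lambda>\<omega>. s\<phi> \<tau> \<omega> $ j))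
          \<le> u $ j * expect N (\<lambda>\<omega>. backlog N \<phi> t \<omega> $ j)"
        using policy_expect_backlog u by (intro mult_left_mono) (auto simp: nonneg_def)
      also have "\<dots> \<le> norm u * expect N (\<lambda>\<omega>. backlog N \<phi> t \<omega> $ j)"
        using component_le_norm_cart[of u j] eb by (intro mult_right_mono) auto
      finally show "u $ j * (\<Sum>\<tau><t. expect N (\<lambda>\<omega>. a\<phi> \<tau> \<omega> $ j) - expect N (\<lambda>\<omega>. s\<phi> \<tau> \<omega> $ j))
          \<le> norm u * expect N (\<lambda>\<omega>. backlog N \<phi> t \<omega> $ j)" .
    qed
    finally show ?thesis by (simp add: b_def sum_distrib_left)
  qed
  \<comment> \<open>At the infinitely many times with \<open>b t \<le> C\<close> the backlog term is a constant, which averages out.\<close>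
  have "\<exists>\<^sub>F t in sequentially. lagrangian u u / V * real t - norm u * C / V \<le> (\<Sum>\<tau><t. expect N (c\<phi> \<tau>))"
  proof (rule frequently_elim1[OF C(2)])
    fix t assume "b t \<le> C"
    hence "norm u * b t \<le> norm u * C" by (intro mult_left_mono) auto
    with sum[of t] have "lagrangian u u * real t - norm u * C \<le> V * (\<Sum>\<tau><t. expect N (c\<phi> \<tau>))" by simp
    hence "(lagrangian u u * real t - norm u * C) / V \<le> (\<Sum>\<tau><t. expect N (c\<phi> \<tau>))"
      using V by (simp add: field_simps)
    thus "lagrangian u u / V * real t - norm u * C / V \<le> (\<Sum>\<tau><t. expect N (c\<phi> \<tau>))"
      by (simp add: diff_divide_distrib)
  qed
  thus ?thesis unfolding avg_cost_def by (rule tavg_ge)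
qed

end

end

section \<open>Concentration around the dual maximizer\<close>

text \<open>
  Here \<open>u\<close> is the maximizer of the dual function for \<open>V\<close>, \<open>R\<close> is the distance to it, and \<open>D\<close> is the radius from which
  on the drift towards \<open>u\<close> dominates the noise. The parameters \<open>K\<close>, \<open>a\<close>, \<open>\<kappa>\<close>, \<open>M\<close> depend on the network and
  on \<open>L\<close>, but not on \<open>V\<close>, so that bounds in terms of them are uniform in \<open>V\<close>. Among them, \<open>M\<close> bounds the
  exponential potential one slot after a visit to the ball of radius \<open>D\<close>.
\<close>

locale qla_concentration = qla_chain N \<sigma> V \<delta> B \<Delta>
  for N :: "('s::finite, 'x, 'r::finite) network" and \<sigma> V \<delta> B \<Delta> +
  fixes u :: "real ^ 'r" and \<epsilon> L K a \<kappa> M :: real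
  assumes u: "nonneg u" and L: "L > 0"
    and u_max: "nonneg w \<Longrightarrow> lagrangian w w \<le> lagrangian u u"
    and growth: "nonneg w \<Longrightarrow> norm (w - u) < \<epsilon> * V \<Longrightarrow>
      lagrangian w w + L / V * (norm (w - u))\<^sup>2 \<le> lagrangian u u"
    and K: "K > 0" "L * K\<^sup>2 = 2 * B"
    and a_def: "a = L * K / (4 * \<Delta>\<^sup>2)"
    and \<kappa>_def: "\<kappa> = (L * K)\<^sup>2 / (16 * \<Delta>\<^sup>2)"
    and M_def: "M = exp (a * K + 1)"
    and V_large: "K * sqrt V < \<epsilon> * V" "a * \<Delta> \<le> sqrt V" "\<kappa> \<le> V"
begin

abbreviation R where "R w \<equiv> norm (w - u)"

abbreviation D where "D \<equiv> K * sqrt V"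

lemma R_nth: "\<bar>w $ j - u $ j\<bar> \<le> R w"
  using component_le_norm_cart[of "w - u" j] by simp

lemma D_pos: "D > 0" using K V by simp

lemma L_D: "L * D / V * D = 2 * B"
  using K V by (simp add: power2_eq_square field_simps)

lemma a_pos: "a > 0" using L K \<Delta>_pos by (simp add: a_def)

lemma \<kappa>_pos: "\<kappa> > 0" using L K \<Delta>_pos by (simp add: \<kappa>_def)

text \<open>
  Beyond the radius \<open>D\<close>, concavity of the dual function makes the gap grow at least linearly, at the rate reached
  at distance \<open>D\<close>.
\<close>

lemma dual_gap:
  assumes w: "nonneg w" and far: "D \<le> R w"
  shows "L * D / V * R w \<le> lagrangian u u - lagrangian w w"
proof -
  \<comment> \<open>\<open>v\<close> is the point of the segment from \<open>u\<close> to \<open>w\<close> at distance exactly \<open>D\<close> from \<open>u\<close>,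
    where the quadratic growth bound applies.\<close>
  define \<alpha> where "\<alpha> = D / R w"
  have R: "R w > 0" using D_pos far by linarith
  have \<alpha>: "0 < \<alpha>" "\<alpha> \<le> 1" using D_pos far R by (auto simp: \<alpha>_def)
  define v where "v = \<alpha> *\<^sub>R w + (1 - \<alpha>) *\<^sub>R u"
  have v: "nonneg v" using w u \<alpha> by (auto simp: v_def nonneg_def intro!: add_nonneg_nonneg)
  have "v - u = \<alpha> *\<^sub>R (w - u)" by (simp add: v_def algebra_simps)
  hence "R v = \<alpha> * R w" using \<alpha> by simp
  hence Rv: "R v = D" using R by (simp add: \<alpha>_def)
  have "\<alpha> * lagrangian w w + (1 - \<alpha>) * lagrangian u u \<le> \<alpha> * lagrangian w v + (1 - \<alpha>) * lagrangian u v"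
    using \<alpha> lagrangian_min[OF w v] lagrangian_min[OF u v] by (intro add_mono mult_left_mono) auto
  also have "\<dots> = lagrangian v v" by (simp add: v_def lagrangian_affine)
  also have "\<dots> \<le> lagrangian u u - L / V * D\<^sup>2"
    using growth[OF v] Rv V_large(1) by simp
  finally have "L / V * D\<^sup>2 \<le> \<alpha> * (lagrangian u u - lagrangian w w)" by (simp add: algebra_simps)
  also have "\<dots> = D * (lagrangian u u - lagrangian w w) / R w" by (simp add: \<alpha>_def)
  finally have "L / V * D\<^sup>2 * R w \<le> D * (lagrangian u u - lagrangian w w)"
    using R by (simp add: pos_le_divide_eq)
  moreover have "L / V * D\<^sup>2 * R w = D * (L * D / V * R w)" by (simp add: power2_eq_square)
  ultimately have "D * (L * D / V * R w) \<le> D * (lagrangian u u - lagrangian w w)" by (simp only:)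
  thus ?thesis using D_pos by (simp only: mult_le_cancel_left_pos)
qed

text \<open>
  Summing the quadratic drift bounds the average distance to \<open>u\<close> by a multiple of \<open>sqrt V\<close>. Inside the radius \<open>D\<close> the
  term \<open>L * D / V * R w\<close> is at most \<open>2 * B\<close>, which is where the constant \<open>6 * B\<close> comes from.
\<close>

lemma distance_sum:
  assumes w: "nonneg w"
  shows "2 * (L * D / V) * (\<Sum>\<tau><t. transition N \<sigma> \<tau> R w) \<le> (R w)\<^sup>2 + 6 * B * real t"
proof -
  have "(\<Sum>\<tau><t. transition N \<sigma> \<tau> (\<lambda>w. 2 * (L * D / V) * R w) w)
      \<le> (R w)\<^sup>2 + (\<Sum>\<tau><t. transition N \<sigma> \<tau> (\<lambda>w. 6 * B) w)"
  proof (rule drift_sum[OF _ _ w])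
    fix w :: "real ^ 'r" assume w: "nonneg w"
    have c: "L * D / V \<ge> 0" using L D_pos V by simp
    have "L * D / V * R w \<le> lagrangian u u - lagrangian w w + 2 * B"
    proof (cases "D \<le> R w")
      case True thus ?thesis using dual_gap[OF w] B_pos by simp
    next
      case False
      hence "L * D / V * R w \<le> 2 * B" unfolding L_D[symmetric]
        using c by (intro mult_left_mono) auto
      thus ?thesis using u_max[OF w] by simp
    qed
    moreover have "2 * x + m \<le> r + 6 * b" if "x \<le> p - q + 2 * b" "m \<le> r + 2 * b - 2 * (p - q)"
      for x m r p q b :: real using that by argo
    ultimately show "2 * (L * D / V) * R w + mean N (\<lambda>s. (R (nxt w s))\<^sup>2) \<le> (R w)\<^sup>2 + 6 * B"
      using square_drift[OF w u] unfolding mult.assoc[of 2] by blast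
  qed simp
  moreover have "(\<Sum>\<tau><t. transition N \<sigma> \<tau> (\<lambda>w. 6 * B) w) = 6 * B * real t" by simp
  ultimately show ?thesis by (simp only: transition_cmult sum_distrib_left)
qed

lemma avg_distance:
  assumes \<W>: "nonneg \<W>" and k: "k \<ge> 0"
  shows "tavg (\<lambda>t. k * transition N \<sigma> t R \<W> + c) \<le> ereal (k * (3 * B * sqrt V / (L * K)) + c)"
proof (rule tavg_le)
  fix t
  define \<beta> where "\<beta> = 2 * (L * D / V)"
  have \<beta>: "\<beta> > 0" using L D_pos V by (simp add: \<beta>_def)
  have "\<beta> * (\<Sum>\<tau><t. transition N \<sigma> \<tau> R \<W>) \<le> (R \<W>)\<^sup>2 + 6 * B * real t"
    using distance_sum[OF \<W>] by (simp add: \<beta>_def)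
  hence "(\<Sum>\<tau><t. transition N \<sigma> \<tau> R \<W>) \<le> (R \<W>)\<^sup>2 / \<beta> + 6 * B / \<beta> * real t"
    using \<beta> by (simp add: field_simps)
  also have "6 * B / \<beta> = 3 * B * sqrt V / (L * K)"
    using V L K by (simp add: \<beta>_def field_simps)
  finally have "k * (\<Sum>\<tau><t. transition N \<sigma> \<tau> R \<W>)
      \<le> k * ((R \<W>)\<^sup>2 / \<beta> + 3 * B * sqrt V / (L * K) * real t)"
    using k by (intro mult_left_mono)
  thus "(\<Sum>\<tau><t. k * transition N \<sigma> \<tau> R \<W> + c)
      \<le> k * ((R \<W>)\<^sup>2 / \<beta>) + (k * (3 * B * sqrt V / (L * K)) + c) * real t"
    by (simp add: sum.distrib sum_distrib_left[symmetric] algebra_simps)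
qed

lemma distance_drift:
  assumes w: "nonneg w" and far: "D \<le> R w"
  shows "mean N (\<lambda>s. R (nxt w s)) \<le> R w - L * D / (2 * V)"
proof -
  have R: "R w > 0" using D_pos far by linarith
  \<comment> \<open>The arithmetic-geometric mean inequality linearises the drift of the squared distance.\<close>
  have "R (nxt w s) \<le> (1 / (2 * R w)) * ((R (nxt w s))\<^sup>2 + (R w)\<^sup>2)" for s
  proof -
    have "0 \<le> (R (nxt w s) - R w)\<^sup>2" by simp
    thus ?thesis using R by (simp add: field_simps power2_eq_square)
  qed
  hence "mean N (\<lambda>s. R (nxt w s)) \<le> mean N (\<lambda>s. (1 / (2 * R w)) * ((R (nxt w s))\<^sup>2 + (R w)\<^sup>2))"
    by (rule mean_mono)
  also have "\<dots> = (1 / (2 * R w)) * (mean N (\<lambda>s. (R (nxt w s))\<^sup>2) + (R w)\<^sup>2)"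
    by (simp only: mean_cmult mean_add mean_const)
  also have "\<dots> \<le> (1 / (2 * R w)) * (2 * (R w)\<^sup>2 - L * D / V * R w)"
  proof (rule mult_left_mono)
    have "2 * B \<le> L * D / V * R w"
      unfolding L_D[symmetric] using L D_pos V far by (intro mult_left_mono) auto
    moreover have "m + r \<le> 2 * r - x" if "2 * b \<le> x" "m \<le> r + 2 * b - 2 * (p - q)" "x \<le> p - q"
      for x m r p q b :: real using that by argo
    ultimately show "mean N (\<lambda>s. (R (nxt w s))\<^sup>2) + (R w)\<^sup>2 \<le> 2 * (R w)\<^sup>2 - L * D / V * R w"
      using square_drift[OF w u] dual_gap[OF w far] by blast
  qed (use R in auto)
  also have "\<dots> = R w - L * D / (2 * V)"
    using R V by (simp add: field_simps power2_eq_square)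
  finally show ?thesis .
qed

text \<open>
  The order \<open>1 / sqrt V\<close> balances the two contributions to the drift of \<open>exp (\<theta> * R)\<close>: the linear one, \<open>\<theta>\<close> times a drift of order
  \<open>1 / sqrt V\<close>, and the quadratic one, \<open>\<theta>\<^sup>2\<close> times a bounded squared increment. Both are of order \<open>1 / V\<close>.
\<close>

definition \<theta> where "\<theta> = a / sqrt V"

abbreviation F where "F w \<equiv> exp (\<theta> * R w)"

lemma \<theta>_pos: "\<theta> > 0" using a_pos V by (simp add: \<theta>_def)

lemma \<theta>_le: "\<theta> \<le> a"
  using V a_pos by (simp add: \<theta>_def divide_le_eq)

lemma \<theta>_\<Delta>: "\<theta> * \<Delta> \<le> 1" using V_large(2) V by (simp add: \<theta>_def)

lemma distance_jump: "nonneg w \<Longrightarrow> \<bar>R (nxt w s) - R w\<bar> \<le> norm (nxt w s - w)"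
  using norm_triangle_ineq3[of "nxt w s - u" "w - u"] by simp

lemma exp_le_quadratic:
  fixes x :: real assumes "\<bar>x\<bar> \<le> 1" shows "exp x \<le> 1 + x + x\<^sup>2"
proof (cases "0 \<le> x")
  case True thus ?thesis using assms by (intro exp_bound) auto
next
  case False
  define y where "y = - x"
  have y: "0 \<le> y" using False by (simp add: y_def)
  have "1 \<le> (1 - y + y\<^sup>2) * (1 + y + y\<^sup>2 / 2)"
  proof -
    have "(1 - y + y\<^sup>2) * (1 + y + y\<^sup>2 / 2) = 1 + y^2 / 2 + y^3 / 2 + y^4 / 2"
      by (simp add: field_simps power2_eq_square power3_eq_cube power4_eq_xxxx)
    thus ?thesis using y by simp
  qed
  also have "\<dots> \<le> (1 - y + y\<^sup>2) * exp y"
  proof (rule mult_left_mono[OF exp_lower_Taylor_quadratic[OF y]])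
    have "0 \<le> (y - 1/2)^2" by simp
    thus "0 \<le> 1 - y + y\<^sup>2" by (simp add: power2_eq_square algebra_simps)
  qed
  finally have "exp (- y) \<le> 1 - y + y\<^sup>2"
    by (simp add: exp_minus field_simps)
  thus ?thesis by (simp add: y_def)
qed

lemma exp_drift_far:
  assumes w: "nonneg w" and far: "D \<le> R w"
  shows "mean N (\<lambda>s. F (nxt w s)) \<le> (1 - \<kappa> / V) * F w"
proof -
  have "F (nxt w s) \<le> F w * (1 + \<theta>\<^sup>2 * \<Delta>\<^sup>2 - \<theta> * R w) + F w * \<theta> * R (nxt w s)" for s
  proof -
    define d where "d = R (nxt w s) - R w"
    have d: "\<bar>d\<bar> \<le> \<Delta>"
      using distance_jump[OF w, of s] norm_jump[OF w, of s] by (simp add: d_def)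
    have "\<theta> * \<bar>d\<bar> \<le> \<theta> * \<Delta>" using d \<theta>_pos by (intro mult_left_mono) auto
    hence d': "\<bar>\<theta> * d\<bar> \<le> \<theta> * \<Delta>" using \<theta>_pos by (simp add: abs_mult)
    have "exp (\<theta> * d) \<le> 1 + \<theta> * d + (\<theta> * d)\<^sup>2"
      using d' \<theta>_\<Delta> by (intro exp_le_quadratic) linarith
    also have "(\<theta> * d)\<^sup>2 \<le> (\<theta> * \<Delta>)\<^sup>2"
      using d' by (metis abs_le_square_iff abs_of_nonneg abs_ge_zero order_trans)
    finally have "F w * exp (\<theta> * d) \<le> F w * (1 + \<theta> * d + (\<theta> * \<Delta>)\<^sup>2)"
      by (intro mult_left_mono) auto
    moreover have "F w * exp (\<theta> * d) = F (nxt w s)"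
      by (simp add: d_def exp_add[symmetric] algebra_simps)
    ultimately show ?thesis by (simp add: d_def power_mult_distrib algebra_simps)
  qed
  hence "mean N (\<lambda>s. F (nxt w s))
      \<le> mean N (\<lambda>s. F w * (1 + \<theta>\<^sup>2 * \<Delta>\<^sup>2 - \<theta> * R w) + F w * \<theta> * R (nxt w s))"
    by (rule mean_mono)
  also have "\<dots> = F w * (1 + \<theta>\<^sup>2 * \<Delta>\<^sup>2 - \<theta> * R w) + F w * \<theta> * mean N (\<lambda>s. R (nxt w s))"
    by (simp only: mean_add mean_cmult mean_const)
  also have "\<dots> \<le> F w * (1 + \<theta>\<^sup>2 * \<Delta>\<^sup>2 - \<theta> * R w) + F w * \<theta> * (R w - L * D / (2 * V))"
    using distance_drift[OF w far] \<theta>_pos by (intro add_left_mono mult_left_mono) auto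
  also have "\<dots> = F w * (1 + (\<theta>\<^sup>2 * \<Delta>\<^sup>2 - \<theta> * (L * D / (2 * V))))" by (simp add: algebra_simps)
  also have "\<theta>\<^sup>2 * \<Delta>\<^sup>2 - \<theta> * (L * D / (2 * V)) = - (\<kappa> / V)"
  proof -
    have "\<theta>\<^sup>2 * \<Delta>\<^sup>2 = a * (a * \<Delta>\<^sup>2) / V"
      using V by (simp add: \<theta>_def power_divide power2_eq_square)
    moreover have "\<theta> * (L * D / (2 * V)) = a * (L * K / 2) / V"
    proof -
      have "\<theta> * sqrt V = a" using V by (simp add: \<theta>_def)
      moreover have "\<theta> * (L * D / (2 * V)) = (\<theta> * sqrt V) * (L * K / 2) / V" by simp
      ultimately show ?thesis by (simp only:)
    qed
    moreover have "a * \<Delta>\<^sup>2 = L * K / 4" using \<Delta>_pos by (simp add: a_def)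
    moreover have "\<kappa> = a * (L * K / 4)" using \<Delta>_pos by (simp add: a_def \<kappa>_def power2_eq_square)
    moreover have "a * (L * K / 4) / V - a * (L * K / 2) / V = - (a * (L * K / 4) / V)" by simp
    ultimately show ?thesis by (simp only:)
  qed
  finally show ?thesis by (simp add: algebra_simps)
qed

lemma exp_bound_near:
  assumes w: "nonneg w" and near: "R w < D"
  shows "F (nxt w s) \<le> M"
proof -
  have "R (nxt w s) \<le> D + \<Delta>"
    using distance_jump[OF w, of s] norm_jump[OF w, of s] near by simp
  hence "\<theta> * R (nxt w s) \<le> \<theta> * (D + \<Delta>)" using \<theta>_pos by (intro mult_left_mono) auto
  also have "\<dots> \<le> a * K + 1" using \<theta>_\<Delta> V by (simp add: distrib_left \<theta>_def)
  finally show ?thesis by (simp add: M_def)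
qed

text \<open>
  Close to \<open>u\<close> the potential increases at most in proportion to the traffic. A constant bound would be useless for
  the drop fraction, since the chain may be almost idle near \<open>u\<close>.
\<close>

lemma exp_drift_near:
  assumes w: "nonneg w" and near: "R w < D"
  shows "F (nxt w s) \<le> F w + M * \<theta> * traffic w s"
proof -
  define d where "d = \<theta> * R (nxt w s) - \<theta> * R w"
  \<comment> \<open>Convexity: the tangent of \<open>exp\<close> at the new exponent lies below \<open>exp\<close>.\<close>
  have "1 - d \<le> exp (- d)" using exp_ge_add_one_self[of "- d"] by simp
  hence "F (nxt w s) * (1 - d) \<le> F (nxt w s) * exp (- d)" by (intro mult_left_mono) auto
  also have "\<dots> = F w" by (simp add: d_def exp_add[symmetric])
  finally have "F (nxt w s) \<le> F w + F (nxt w s) * d" by (simp add: algebra_simps)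
  also have "F (nxt w s) * d \<le> F (nxt w s) * (\<theta> * traffic w s)"
  proof (rule mult_left_mono)
    have "R (nxt w s) - R w \<le> traffic w s"
      using distance_jump[OF w, of s] norm_jump_traffic[OF w, of s] by simp
    hence "\<theta> * (R (nxt w s) - R w) \<le> \<theta> * traffic w s"
      using \<theta>_pos by (intro mult_left_mono) auto
    thus "d \<le> \<theta> * traffic w s" by (simp add: d_def algebra_simps)
  qed simp
  also have "F (nxt w s) * (\<theta> * traffic w s) \<le> M * (\<theta> * traffic w s)"
    using exp_bound_near[OF w near] \<theta>_pos traffic_nonneg[OF w] by (intro mult_right_mono) auto
  finally show ?thesis by simp
qed

lemma exp_moment:
  assumes w: "nonneg w"
  shows "transition N \<sigma> t F w \<le> (1 - \<kappa> / V) ^ t * F w + M * V / \<kappa>"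
proof -
  have "transition N \<sigma> t F w \<le> (1 - \<kappa> / V) ^ t * F w + M / (\<kappa> / V)"
  proof (rule contraction[OF _ _ _ _ w])
    fix w :: "real ^ 'r" assume w: "nonneg w"
    show "mean N (\<lambda>s. F (nxt w s)) \<le> (1 - \<kappa> / V) * F w + M"
    proof (cases "D \<le> R w")
      case True
      thus ?thesis using exp_drift_far[OF w True] by (simp add: M_def add_increasing2)
    next
      case False
      have "mean N (\<lambda>s. F (nxt w s)) \<le> mean N (\<lambda>s. M)"
        using False by (intro mean_mono exp_bound_near[OF w]) auto
      moreover have "0 \<le> (1 - \<kappa> / V) * F w" using V_large(3) V by simp
      ultimately show ?thesis by simp
    qed
  qed (use \<kappa>_pos V V_large(3) in \<open>auto simp: M_def\<close>)
  thus ?thesis by simp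
qed

text \<open>
  Each visit at distance at least \<open>l\<close> costs potential, which can only be regained by traffic. The price of
  a visit contains the factor \<open>exp (\<theta> * l)\<close>, so visits are rare compared to the traffic.
\<close>

lemma far_visits:
  assumes w: "nonneg w" and l: "D \<le> l"
  shows "(\<Sum>\<tau><t. transition N \<sigma> \<tau> (\<lambda>w. if l \<le> R w then 1 else 0) w)
    \<le> V / \<kappa> * exp (- \<theta> * l) * (F w + M * \<theta> * (\<Sum>\<tau><t. transition N \<sigma> \<tau> (\<lambda>w. mean N (traffic w)) w))"
proof -
  let ?I = "\<lambda>w. if l \<le> R w then 1 else 0 :: real"
  \<comment> \<open>At distance at least \<open>l\<close> the expected decrease of \<open>F\<close> in one slot is at least \<open>c\<close>.\<close>
  define c where "c = \<kappa> / V * exp (\<theta> * l)"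
  have c: "c > 0" using \<kappa>_pos V by (simp add: c_def)
  have M\<theta>: "0 \<le> M * \<theta>" using \<theta>_pos by (simp add: M_def)
  have "(\<Sum>\<tau><t. transition N \<sigma> \<tau> (\<lambda>w. c * ?I w) w)
      \<le> F w + (\<Sum>\<tau><t. transition N \<sigma> \<tau> (\<lambda>w. M * \<theta> * mean N (traffic w)) w)"
  proof (rule drift_sum[OF _ _ w])
    fix w :: "real ^ 'r" assume w: "nonneg w"
    have T: "0 \<le> mean N (traffic w)"
      using mean_mono[of "\<lambda>_. 0" "traffic w" N] traffic_nonneg[OF w] by simp
    show "c * ?I w + mean N (\<lambda>s. F (nxt w s)) \<le> F w + M * \<theta> * mean N (traffic w)"
    proof (cases "D \<le> R w")
      case True
      have "c * ?I w \<le> \<kappa> / V * F w"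
      proof (cases "l \<le> R w")
        case True
        hence "exp (\<theta> * l) \<le> F w" using \<theta>_pos by simp
        thus ?thesis using True \<kappa>_pos V by (simp add: c_def divide_right_mono)
      qed (use \<kappa>_pos V in simp)
      moreover have "0 \<le> M * \<theta> * mean N (traffic w)" using M\<theta> T by (rule mult_nonneg_nonneg)
      ultimately show ?thesis using exp_drift_far[OF w True] by (simp add: algebra_simps)
    next
      case False
      hence "?I w = 0" using l by simp
      moreover have "mean N (\<lambda>s. F (nxt w s)) \<le> mean N (\<lambda>s. F w + M * \<theta> * traffic w s)"
        using False by (intro mean_mono exp_drift_near[OF w]) simp
      moreover have "mean N (\<lambda>s. F w + M * \<theta> * traffic w s) = F w + M * \<theta> * mean N (traffic w)"
        by (simp only: mean_add mean_cmult mean_const)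
      ultimately show ?thesis by (simp only:)
    qed
  qed simp
  hence "c * (\<Sum>\<tau><t. transition N \<sigma> \<tau> ?I w)
      \<le> F w + M * \<theta> * (\<Sum>\<tau><t. transition N \<sigma> \<tau> (\<lambda>w. mean N (traffic w)) w)"
    by (simp only: transition_cmult sum_distrib_left)
  hence "(\<Sum>\<tau><t. transition N \<sigma> \<tau> ?I w)
      \<le> 1 / c * (F w + M * \<theta> * (\<Sum>\<tau><t. transition N \<sigma> \<tau> (\<lambda>w. mean N (traffic w)) w))"
    using c by (simp add: pos_le_divide_eq mult.commute)
  moreover have "1 / c = V / \<kappa> * exp (- \<theta> * l)"
    by (simp add: c_def exp_minus divide_inverse)
  ultimately show ?thesis by (simp only:)
qed

end

section \<open>FQLA driven by the QLA chain\<close>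

context qla_chain
begin

lemma policy_fqla:
  assumes \<W>: "nonneg \<W>"
  shows "policy N (fqla_policy N \<sigma> \<W>)"
  unfolding policy_def
proof (intro conjI allI impI)
  fix t \<omega>
  show "fqla_policy N \<sigma> \<W> t \<omega> \<in> acts N (fst (\<omega> t))"
    unfolding fqla_policy_def by (intro act nonneg_qla \<W>)
next
  fix t and \<omega> \<omega>' :: "nat \<Rightarrow> 's \<times> real"
  assume "\<forall>i\<le>t. \<omega> i = \<omega>' i"
  thus "fqla_policy N \<sigma> \<W> t \<omega> = fqla_policy N \<sigma> \<W> t \<omega>'"
    using qla_backlog_cong[of t \<omega> \<omega>' N \<sigma> \<W>] by (simp add: fqla_policy_def)
next
  fix t
  show "(\<lambda>\<omega>. cost N (fst (\<omega> t)) (fqla_policy N \<sigma> \<W> t \<omega>)) \<in> borel_measurable (sample N)"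
    unfolding fqla_policy_def
    by (rule measurable_determined[OF determined_qla[where h="\<lambda>w s. cost N s (\<sigma> w s)"]]) simp
  show "(\<lambda>\<omega>. arr N (fst (\<omega> t)) (fqla_policy N \<sigma> \<W> t \<omega>)) \<in> borel_measurable (sample N)"
    unfolding fqla_policy_def
    by (rule measurable_determined[OF determined_qla[where h="\<lambda>w s. arr N s (\<sigma> w s)"]]) simp
  show "(\<lambda>\<omega>. srv N (fst (\<omega> t)) (fqla_policy N \<sigma> \<W> t \<omega>)) \<in> borel_measurable (sample N)"
    unfolding fqla_policy_def
    by (rule measurable_determined[OF determined_qla[where h="\<lambda>w s. srv N s (\<sigma> w s)"]]) simp
qed

lemma qla_backlog_nth_Suc:
  "qla_backlog N \<sigma> \<W> (Suc t) \<omega> $ j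
     = max (qla_backlog N \<sigma> \<W> t \<omega> $ j - srv N (fst (\<omega> t)) (fqla_policy N \<sigma> \<W> t \<omega>) $ j) 0
       + fqla_arr N \<sigma> \<W> t \<omega> $ j"
  by (simp add: queue_update_def Let_def fqla_policy_def fqla_arr_def)

lemma backlog_le_qla:
  assumes \<W>: "nonneg \<W>"
  shows "backlog N (fqla_policy N \<sigma> \<W>) t \<omega> $ j \<le> qla_backlog N \<sigma> \<W> t \<omega> $ j"
proof (induction t)
  case 0 show ?case using \<W> by (simp add: nonneg_def)
next
  case (Suc t)
  thus ?case unfolding qla_backlog_nth_Suc backlog_nth_Suc fqla_arr_def by (intro add_right_mono) auto
qed

text \<open>
  The extra \<open>\<delta>\<close> covers the following case: when the service exceeds the real backlog, the real queue stops at zero while \<open>W\<close>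
  continues to fall, and the admitted arrivals of that slot then remain in the real queue even if \<open>W\<close> ends below
  the threshold.
\<close>

lemma fqla_backlog_le:
  assumes \<W>: "nonneg \<W>"
  shows "fqla_backlog N \<sigma> \<W> t \<omega> $ j \<le> max (qla_backlog N \<sigma> \<W> t \<omega> $ j - \<W> $ j) 0 + \<delta>"
proof (induction t)
  case 0 show ?case using \<delta> by simp
next
  case (Suc t)
  define m where "m = srv N (fst (\<omega> t)) (fqla_policy N \<sigma> \<W> t \<omega>) $ j"
  define a where "a = fqla_arr N \<sigma> \<W> t \<omega> $ j"
  define w where "w = qla_backlog N \<sigma> \<W> t \<omega> $ j"
  define v where "v = fqla_backlog N \<sigma> \<W> t \<omega> $ j"
  have "a \<le> \<delta>" "0 \<le> m"
    unfolding a_def m_def fqla_arr_def fqla_policy_def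
    using ar_bounds(2)[OF nonneg_qla[OF \<W>]] sr_bounds(1)[OF nonneg_qla[OF \<W>]] by auto
  moreover have "v \<le> max (w - \<W> $ j) 0 + \<delta>" using Suc by (simp add: v_def w_def)
  moreover have "fqla_backlog N \<sigma> \<W> (Suc t) \<omega> $ j
      = max (v - m) 0 + (if w \<ge> \<W> $ j then a else max (a - \<W> $ j + w) 0)"
    by (simp add: queue_update_def fqla_admitted_def v_def m_def a_def w_def Let_def)
  moreover have "qla_backlog N \<sigma> \<W> (Suc t) \<omega> $ j = max (w - m) 0 + a"
    unfolding qla_backlog_nth_Suc by (simp add: w_def m_def a_def)
  ultimately show ?case using \<delta> by (smt (verit))
qed

lemma determined_fqla_backlog: "determined t (\<lambda>\<omega>. fqla_backlog N \<sigma> \<W> t \<omega>)"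
  unfolding determined_def
proof (intro allI impI)
  fix \<omega> \<omega>' :: "nat \<Rightarrow> 's \<times> real"
  assume "\<forall>i<t. fst (\<omega> i) = fst (\<omega>' i)"
  thus "fqla_backlog N \<sigma> \<W> t \<omega> = fqla_backlog N \<sigma> \<W> t \<omega>'"
  proof (induction t)
    case (Suc t)
    moreover have "qla_backlog N \<sigma> \<W> t \<omega> = qla_backlog N \<sigma> \<W> t \<omega>'"
      using Suc.prems by (intro qla_backlog_cong) simp
    ultimately show ?case by (simp add: fqla_policy_def fqla_admitted_def fqla_arr_def)
  qed simp
qed

lemma total_arrivals_eq:
  "total_arrivals N \<sigma> \<W> t = (\<Sum>\<tau><t. transition N \<sigma> \<tau> (\<lambda>w. mean N (\<lambda>s. \<Sum>j\<in>UNIV. ar w s $ j)) \<W>)"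
  unfolding total_arrivals_def fqla_arr_def fqla_policy_def
    expect_qla[of N "\<lambda>w s. ar w s $ j" for j] mean_sum
  by (simp add: transition_sum)

text \<open>
  The predicate \<open>P\<close> stands for being far from the dual maximizer. In a slot with \<open>W\<close> at or above the threshold in all coordinates
  nothing is dropped; in any other slot at most everything is.
\<close>

lemma total_dropped_le:
  assumes \<W>: "nonneg \<W>"
    and far: "\<And>w j. nonneg w \<Longrightarrow> w $ j < \<W> $ j \<Longrightarrow> P w"
  shows "total_dropped N \<sigma> \<W> t \<le> \<Delta> * (\<Sum>\<tau><t. transition N \<sigma> \<tau> (\<lambda>w. if P w then 1 else 0) \<W>)"
proof -
  define d where "d j w s = ar w s $ j -
      (if w $ j \<ge> \<W> $ j then ar w s $ j else max (ar w s $ j - \<W> $ j + w $ j) 0)" for j w s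
  have "total_dropped N \<sigma> \<W> t = (\<Sum>\<tau><t. \<Sum>j\<in>UNIV. expect N (\<lambda>\<omega>. d j (qla_backlog N \<sigma> \<W> \<tau> \<omega>) (fst (\<omega> \<tau>))))"
    unfolding total_dropped_def d_def
    by (simp add: fqla_admitted_def fqla_arr_def fqla_policy_def Let_def)
  also have "\<dots> = (\<Sum>\<tau><t. \<Sum>j\<in>UNIV. transition N \<sigma> \<tau> (\<lambda>w. mean N (d j w)) \<W>)"
    by (simp only: expect_qla)
  also have "\<dots> \<le> (\<Sum>\<tau><t. \<Sum>j\<in>(UNIV :: 'r set). transition N \<sigma> \<tau> (\<lambda>w. \<delta> * (if P w then 1 else 0)) \<W>)"
  proof (intro sum_mono transition_mono \<W>)
    fix j and w :: "real ^ 'r" assume w: "nonneg w"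
    have "mean N (d j w) \<le> mean N (\<lambda>s. \<delta> * (if P w then 1 else 0))"
    proof (rule mean_mono)
      fix s
      show "d j w s \<le> \<delta> * (if P w then 1 else 0)"
        using far[OF w, of j] ar_bounds[OF w, of s j] \<delta> by (auto simp: d_def)
    qed
    thus "mean N (d j w) \<le> \<delta> * (if P w then 1 else 0)" by simp
  qed
  also have "\<dots> = \<Delta> * (\<Sum>\<tau><t. transition N \<sigma> \<tau> (\<lambda>w. if P w then 1 else 0) \<W>)"
    by (simp only: transition_cmult) (simp add: \<Delta>_def sum_distrib_left mult.assoc)
  finally show ?thesis .
qed

end

context qla_concentration
begin

lemma stable_fqla:
  assumes \<W>: "nonneg \<W>"
  shows "stable N (fqla_policy N \<sigma> \<W>)"
proof -
  have "avg_backlog N (fqla_policy N \<sigma> \<W>)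
      \<le> tavg (\<lambda>t. real CARD('r) * transition N \<sigma> t R \<W> + (\<Sum>j\<in>UNIV. u $ j))"
    unfolding avg_backlog_def
  proof (rule tavg_mono)
    fix t
    have "(\<Sum>j\<in>UNIV. expect N (\<lambda>\<omega>. backlog N (fqla_policy N \<sigma> \<W>) t \<omega> $ j))
        \<le> (\<Sum>j\<in>UNIV. expect N (\<lambda>\<omega>. R (qla_backlog N \<sigma> \<W> t \<omega>) + u $ j))"
    proof (intro sum_mono integral_mono policy_backlog_integrable policy_fqla \<W>)
      fix j \<omega>
      show "integrable (sample N) (\<lambda>\<omega>. R (qla_backlog N \<sigma> \<W> t \<omega>) + u $ j)"
        by (rule integrable_determined[OF determined_comp[OF determined_qla_backlog]])
      show "backlog N (fqla_policy N \<sigma> \<W>) t \<omega> $ j \<le> R (qla_backlog N \<sigma> \<W> t \<omega>) + u $ j"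
        using backlog_le_qla[OF \<W>, of t \<omega> j] R_nth[of "qla_backlog N \<sigma> \<W> t \<omega>" j] by linarith
    qed
    also have "\<dots> = (\<Sum>j\<in>UNIV. transition N \<sigma> t (\<lambda>w. R w + u $ j) \<W>)"
      by (simp only: expect_qla_backlog[of N "\<lambda>w. R w + u $ j" for j])
    also have "\<dots> = real CARD('r) * transition N \<sigma> t R \<W> + (\<Sum>j\<in>UNIV. u $ j)"
      by (simp add: transition_add sum.distrib)
    finally show "(\<Sum>j\<in>UNIV. expect N (\<lambda>\<omega>. backlog N (fqla_policy N \<sigma> \<W>) t \<omega> $ j))
        \<le> real CARD('r) * transition N \<sigma> t R \<W> + (\<Sum>j\<in>UNIV. u $ j)" .
  qed
  also have "\<dots> \<le> ereal (real CARD('r) * (3 * B * sqrt V / (L * K)) + (\<Sum>j\<in>UNIV. u $ j))"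
    by (rule avg_distance[OF \<W>]) simp
  also have "\<dots> < \<infinity>" by simp
  finally show ?thesis unfolding stable_def .
qed

text \<open>
  The optimum is at most the cost of FQLA because FQLA without dropping is itself a stable policy.
  Hence both numbers lie in the interval of length \<open>B / V\<close> that starts at the dual optimum over \<open>V\<close>.
\<close>

lemma cost_fqla:
  assumes \<W>: "nonneg \<W>"
  shows "\<bar>avg_cost N (fqla_policy N \<sigma> \<W>) - opt_cost N\<bar> \<le> ereal (B / V)"
proof -
  have lower: "ereal (lagrangian u u / V) \<le> opt_cost N"
    unfolding opt_cost_def using weak_duality[OF _ u] by (intro INF_greatest) simp
  have mid: "opt_cost N \<le> avg_cost N (fqla_policy N \<sigma> \<W>)"
    unfolding opt_cost_def using policy_fqla[OF \<W>] stable_fqla[OF \<W>] by (intro INF_lower) simp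
  have upper: "avg_cost N (fqla_policy N \<sigma> \<W>) \<le> ereal (lagrangian u u / V + B / V)"
    unfolding avg_cost_def fqla_policy_def expect_qla[of N "\<lambda>w s. cst w s"]
  proof (rule tavg_le)
    fix t
    have "V * (\<Sum>\<tau><t. transition N \<sigma> \<tau> (\<lambda>w. mean N (cst w)) \<W>)
        \<le> (norm \<W>)\<^sup>2 / 2 + real t * (B + lagrangian u u)"
      by (rule cost_sum[OF \<W> u_max])
    hence "(\<Sum>\<tau><t. transition N \<sigma> \<tau> (\<lambda>w. mean N (cst w)) \<W>)
        \<le> ((norm \<W>)\<^sup>2 / 2 + real t * (B + lagrangian u u)) / V"
      using V by (simp add: pos_le_divide_eq mult.commute)
    thus "(\<Sum>\<tau><t. transition N \<sigma> \<tau> (\<lambda>w. mean N (cst w)) \<W>)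
        \<le> (norm \<W>)\<^sup>2 / 2 / V + (lagrangian u u / V + B / V) * real t"
      by (simp add: add_divide_distrib algebra_simps)
  qed
  show ?thesis
    using lower mid upper
    by (cases "opt_cost N"; cases "avg_cost N (fqla_policy N \<sigma> \<W>)") auto
qed

lemma backlog_fqla:
  assumes \<W>: "nonneg \<W>" and near: "\<And>j. u $ j - \<W> $ j \<le> c"
    and c: "c \<ge> 0"
  shows "fqla_avg_backlog N \<sigma> \<W> \<le> ereal (real CARD('r) * (3 * B * sqrt V / (L * K)) + real CARD('r) * (c + \<delta>))"
proof -
  have "fqla_avg_backlog N \<sigma> \<W>
      \<le> tavg (\<lambda>t. real CARD('r) * transition N \<sigma> t R \<W> + real CARD('r) * (c + \<delta>))"
    unfolding fqla_avg_backlog_def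
  proof (rule tavg_mono)
    fix t
    have "(\<Sum>j\<in>UNIV. expect N (\<lambda>\<omega>. fqla_backlog N \<sigma> \<W> t \<omega> $ j))
        \<le> (\<Sum>j\<in>(UNIV::'r set). expect N (\<lambda>\<omega>. R (qla_backlog N \<sigma> \<W> t \<omega>) + (c + \<delta>)))"
    proof (intro sum_mono integral_mono)
      fix j \<omega>
      show "integrable (sample N) (\<lambda>\<omega>. fqla_backlog N \<sigma> \<W> t \<omega> $ j)"
        by (rule integrable_determined[OF determined_comp[OF determined_fqla_backlog]])
      show "integrable (sample N) (\<lambda>\<omega>. R (qla_backlog N \<sigma> \<W> t \<omega>) + (c + \<delta>))"
        by (rule integrable_determined[OF determined_comp[OF determined_qla_backlog]])
      show "fqla_backlog N \<sigma> \<W> t \<omega> $ j \<le> R (qla_backlog N \<sigma> \<W> t \<omega>) + (c + \<delta>)"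
        using fqla_backlog_le[OF \<W>, of t \<omega> j] R_nth[of "qla_backlog N \<sigma> \<W> t \<omega>" j] near[of j] c
        by (smt (verit))
    qed
    also have "\<dots> = (\<Sum>j\<in>(UNIV::'r set). transition N \<sigma> t (\<lambda>w. R w + (c + \<delta>)) \<W>)"
      by (simp only: expect_qla_backlog[of N "\<lambda>w. R w + (c + \<delta>)"])
    also have "\<dots> = real CARD('r) * transition N \<sigma> t R \<W> + real CARD('r) * (c + \<delta>)"
      by (simp add: transition_add sum.distrib distrib_left)
    finally show "(\<Sum>j\<in>UNIV. expect N (\<lambda>\<omega>. fqla_backlog N \<sigma> \<W> t \<omega> $ j))
        \<le> real CARD('r) * transition N \<sigma> t R \<W> + real CARD('r) * (c + \<delta>)" .
  qed
  also have "\<dots> \<le> ereal (real CARD('r) * (3 * B * sqrt V / (L * K)) + real CARD('r) * (c + \<delta>))"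
    by (rule avg_distance[OF \<W>]) simp
  finally show ?thesis .
qed

text \<open>
  The initial potential and the initial content of the queues are constants, so they vanish in the ratio as the total
  arrivals grow. What remains is the exchange rate between far visits and traffic.
\<close>

lemma drop_fqla:
  assumes \<W>: "nonneg \<W>" and l: "D \<le> l"
    and gap: "\<And>j. \<W> $ j > 0 \<Longrightarrow> \<W> $ j \<le> u $ j - l"
    and arrivals: "filterlim (total_arrivals N \<sigma> \<W>) at_top sequentially"
  shows "drop_fraction N \<sigma> \<W> \<le> ereal (2 * \<Delta> * M * \<theta> * V / \<kappa> * exp (- \<theta> * l))"
proof -
  define \<alpha> where "\<alpha> = V / \<kappa> * exp (- \<theta> * l)"
  have \<alpha>: "\<alpha> \<ge> 0" using V \<kappa>_pos by (simp add: \<alpha>_def)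
  have M\<theta>: "M * \<theta> \<ge> 0" using \<theta>_pos by (simp add: M_def)
  have "total_dropped N \<sigma> \<W> t
      \<le> \<Delta> * (\<alpha> * (F \<W> + M * \<theta> * (\<Sum>j\<in>UNIV. \<W> $ j)))
        + \<Delta> * \<alpha> * M * \<theta> * 2 * total_arrivals N \<sigma> \<W> t" for t
  proof -
    have "total_dropped N \<sigma> \<W> t \<le> \<Delta> * (\<Sum>\<tau><t. transition N \<sigma> \<tau> (\<lambda>w. if l \<le> R w then 1 else 0) \<W>)"
    proof (rule total_dropped_le[OF \<W>])
      fix w :: "real ^ 'r" and j assume "nonneg w" "w $ j < \<W> $ j"
      hence "\<W> $ j > 0" unfolding nonneg_def by (meson order_le_less_trans)
      from gap[OF this] \<open>w $ j < \<W> $ j\<close> R_nth[of w j] show "l \<le> R w" by linarith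
    qed
    also have "\<dots> \<le> \<Delta> * (\<alpha> * (F \<W> + M * \<theta> * (\<Sum>\<tau><t. transition N \<sigma> \<tau> (\<lambda>w. mean N (traffic w)) \<W>)))"
      unfolding \<alpha>_def using far_visits[OF \<W> l] \<Delta>_pos by (intro mult_left_mono) auto
    also have "\<dots> \<le> \<Delta> * (\<alpha> * (F \<W> + M * \<theta> * ((\<Sum>j\<in>UNIV. \<W> $ j) + 2 * total_arrivals N \<sigma> \<W> t)))"
      using traffic_sum[OF \<W>, of t] \<alpha> M\<theta> \<Delta>_pos unfolding total_arrivals_eq
      by (intro mult_left_mono add_left_mono) auto
    finally show ?thesis by (simp add: algebra_simps)
  qed
  from limsup_ratio_le[OF arrivals this] show ?thesis
    unfolding drop_fraction_def by (simp add: \<alpha>_def mult_ac)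
qed

section \<open>Thresholds close to the dual maximizer\<close>

definition margin where "margin = (ln V)\<^sup>2 * sqrt V"

lemma \<theta>_margin: "\<theta> * margin = a * (ln V)\<^sup>2"
  using V by (simp add: \<theta>_def margin_def)

lemma V_exp_tail: "V * exp (- \<theta> * (margin / 2)) = exp (ln V - a * (ln V)\<^sup>2 / 2)"
proof -
  have "- \<theta> * (margin / 2) = - (\<theta> * margin / 2)" by simp
  also have "\<dots> = - (a * (ln V)\<^sup>2 / 2)" unfolding \<theta>_margin by simp
  finally have "V * exp (- \<theta> * (margin / 2)) = exp (ln V) * exp (- (a * (ln V)\<^sup>2 / 2))"
    using V by simp
  also have "\<dots> = exp (ln V - a * (ln V)\<^sup>2 / 2)" unfolding exp_add[symmetric] by simp
  finally show ?thesis .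
qed

text \<open>
  The factor \<open>10\<close> is what the reliability of FQLA-General requires: half of the right-hand side then dominates
  \<open>5 * ln V\<close>, one part for the factor \<open>V\<close> in the moment bound and four for the target \<open>1 / V ^ 4\<close>.
\<close>

lemma square_ln_dominates:
  assumes "10 / a \<le> ln V" "0 \<le> ln V"
  shows "10 * ln V \<le> a * (ln V)\<^sup>2"
proof -
  have "10 \<le> a * ln V" using assms(1) a_pos by (simp add: pos_divide_le_eq mult.commute)
  from mult_right_mono[OF this assms(2)] show ?thesis by (simp only: power2_eq_square mult.assoc)
qed

text \<open>
  Half the margin is left for the fluctuations of \<open>v\<close>: the threshold still lies at least half the margin below
  \<open>u\<close> in every coordinate where it is positive, and at most three halves of it below.
\<close>

lemma performance_near:
  assumes v: "R v \<le> margin / 2"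
    and V': "1 \<le> ln V" "10 / a \<le> ln V" "2 * K \<le> ln V"
    and C: "B \<le> C" "real CARD('r) * (3 * B / (L * K) + 3 / 2 + \<delta>) \<le> C" "2 * \<Delta> * M * a / \<kappa> \<le> C"
  shows "fqla_performance N \<sigma> C (a / 4) V (threshold V v)"
proof -
  define \<W> where "\<W> = threshold V v"
  have \<W>_nth: "\<W> $ j = max (v $ j - margin) 0" for j by (simp add: \<W>_def threshold_def margin_def)
  have \<W>: "nonneg \<W>" by (simp add: nonneg_def \<W>_nth)
  have ln2: "ln V \<le> (ln V)\<^sup>2"
    using V'(1) mult_left_mono[of 1 "ln V" "ln V"] by (simp add: power2_eq_square)
  have sqrt_margin: "sqrt V \<le> margin"
    using ln2 V'(1) V mult_right_mono[of 1 "(ln V)\<^sup>2" "sqrt V"] by (simp add: margin_def)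
  have one_margin: "1 \<le> margin" using sqrt_margin V real_sqrt_ge_one[of V] by linarith
  have "2 * K * sqrt V \<le> margin"
    unfolding margin_def using ln2 V'(3) V by (intro mult_right_mono) auto
  hence D: "D \<le> margin / 2" by simp
  have v_nth: "\<bar>v $ j - u $ j\<bar> \<le> margin / 2" for j using R_nth[of v j] v by linarith
  have "\<bar>avg_cost N (fqla_policy N \<sigma> \<W>) - opt_cost N\<bar> \<le> ereal (B / V)" by (rule cost_fqla[OF \<W>])
  also have "\<dots> \<le> ereal (C / V)" using C(1) V by (simp add: divide_right_mono)
  finally have cost: "\<bar>avg_cost N (fqla_policy N \<sigma> \<W>) - opt_cost N\<bar> \<le> ereal (C / V)" .
  have "fqla_avg_backlog N \<sigma> \<W>
      \<le> ereal (real CARD('r) * (3 * B * sqrt V / (L * K)) + real CARD('r) * (3 / 2 * margin + \<delta>))"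
  proof (rule backlog_fqla[OF \<W>])
    fix j show "u $ j - \<W> $ j \<le> 3 / 2 * margin" using v_nth[of j] unfolding \<W>_nth by linarith
    show "0 \<le> 3 / 2 * margin" using one_margin by simp
  qed
  also have "\<dots> \<le> ereal (C * margin)"
  proof -
    have "\<delta> \<le> \<delta> * margin" using \<delta> one_margin by simp
    moreover have "3 * B / (L * K) * sqrt V \<le> 3 * B / (L * K) * margin"
      using B_pos L K sqrt_margin by (intro mult_left_mono) auto
    ultimately have "3 * B * sqrt V / (L * K) + (3 / 2 * margin + \<delta>) \<le> (3 * B / (L * K) + 3 / 2 + \<delta>) * margin"
      by (simp add: algebra_simps)
    hence "real CARD('r) * (3 * B * sqrt V / (L * K) + (3 / 2 * margin + \<delta>))
        \<le> real CARD('r) * ((3 * B / (L * K) + 3 / 2 + \<delta>) * margin)"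
      by (intro mult_left_mono) auto
    also have "\<dots> = (real CARD('r) * (3 * B / (L * K) + 3 / 2 + \<delta>)) * margin" by simp
    also have "\<dots> \<le> C * margin" using C(2) one_margin by (intro mult_right_mono) auto
    finally show ?thesis by (simp only: distrib_left ereal_less_eq)
  qed
  finally have backlog: "fqla_avg_backlog N \<sigma> \<W> \<le> ereal (C * ((ln V)\<^sup>2 * sqrt V))"
    by (simp add: margin_def)
  have drop: "drop_fraction N \<sigma> \<W> \<le> ereal (C * (1 / V powr (a / 4 * ln V)))"
    if "filterlim (total_arrivals N \<sigma> \<W>) at_top sequentially"
  proof -
    have "drop_fraction N \<sigma> \<W> \<le> ereal (2 * \<Delta> * M * \<theta> * V / \<kappa> * exp (- \<theta> * (margin / 2)))"
    proof (rule drop_fqla[OF \<W> D _ that])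
      fix j assume "\<W> $ j > 0"
      thus "\<W> $ j \<le> u $ j - margin / 2" using v_nth[of j] unfolding \<W>_nth by linarith
    qed
    also have "\<dots> \<le> ereal (C * (1 / V powr (a / 4 * ln V)))"
    proof -
      have "2 * \<Delta> * M * \<theta> * V / \<kappa> * exp (- \<theta> * (margin / 2)) = 2 * \<Delta> * M / \<kappa> * \<theta> * (V * exp (- \<theta> * (margin / 2)))"
        by simp
      also have "\<dots> \<le> 2 * \<Delta> * M / \<kappa> * a * (V * exp (- \<theta> * (margin / 2)))"
        using \<theta>_le \<Delta>_pos \<kappa>_pos V by (intro mult_right_mono mult_left_mono) (auto simp: M_def)
      also have "\<dots> \<le> C * (V * exp (- \<theta> * (margin / 2)))"
        using C(3) V by (intro mult_right_mono) auto
      also have "V * exp (- \<theta> * (margin / 2)) = exp (ln V - a * (ln V)\<^sup>2 / 2)"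
        by (rule V_exp_tail)
      also have "C * exp (ln V - a * (ln V)\<^sup>2 / 2) \<le> C * exp (- (a * (ln V)\<^sup>2 / 4))"
      proof -
        \<comment> \<open>Half of the exponent absorbs the polynomial factor \<open>V\<close>; hence \<open>c0 = a / 4\<close>.\<close>
        have "ln V - a * (ln V)\<^sup>2 / 2 \<le> - (a * (ln V)\<^sup>2 / 4)"
          using square_ln_dominates[OF V'(2)] V'(1) by linarith
        thus ?thesis using C(1) B_pos by (intro mult_left_mono) auto
      qed
      also have "exp (- (a * (ln V)\<^sup>2 / 4)) = 1 / V powr (a / 4 * ln V)"
      proof -
        have "a / 4 * ln V * ln V = a * (ln V)\<^sup>2 / 4" unfolding power2_eq_square by simp
        moreover have "V powr (a / 4 * ln V) = exp (a / 4 * ln V * ln V)"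
          unfolding powr_def using V by (subst if_not_P) auto
        ultimately show ?thesis by (simp only: exp_minus inverse_eq_divide)
      qed
      finally show ?thesis by simp
    qed
    finally show ?thesis .
  qed
  show ?thesis unfolding fqla_performance_def \<W>_def[symmetric] using cost backlog drop by blast
qed

lemma margin_concentration:
  assumes V': "10 / a \<le> ln V" "0 \<le> ln V" and C: "1 + M / \<kappa> \<le> C"
    and T: "(1 - \<kappa> / V) ^ T * F 0 \<le> 1"
  shows "measure (sample N) {\<omega>. R (qla_backlog N \<sigma> 0 T \<omega>) \<le> margin / 2} \<ge> 1 - C / V ^ 4"
proof -
  interpret prob_space "sample N" by (rule prob_space_sample)
  let ?G = "{\<omega>. R (qla_backlog N \<sigma> 0 T \<omega>) \<le> margin / 2}"
  define e where "e = exp (- \<theta> * (margin / 2))"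
  have nn: "nonneg (0 :: real ^ 'r)" by (simp add: nonneg_def)
  have G: "?G \<in> sets (sample N)"
  proof -
    have "(\<lambda>\<omega>. R (qla_backlog N \<sigma> 0 T \<omega>) \<le> margin / 2) \<in> sample N \<rightarrow>\<^sub>M count_space UNIV"
      by (rule measurable_determined[OF determined_comp[OF determined_qla_backlog]]) simp
    thus ?thesis by (simp add: pred_def)
  qed
  have int: "integrable (sample N) (\<lambda>\<omega>. F (qla_backlog N \<sigma> 0 T \<omega>))"
    by (rule integrable_determined[OF determined_comp[OF determined_qla_backlog]])
  have "1 - e * transition N \<sigma> T F 0 = expect N (\<lambda>\<omega>. 1 - e * F (qla_backlog N \<sigma> 0 T \<omega>))"
    using int expect_qla_backlog[of N F \<sigma> 0 T] prob_space by simp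
  \<comment> \<open>Markov's inequality: outside \<open>?G\<close> the product \<open>e * F\<close> is at least \<open>1\<close>.\<close>
  also have "\<dots> \<le> expect N (indicator ?G)"
  proof (rule integral_mono)
    show "integrable (sample N) (\<lambda>\<omega>. 1 - e * F (qla_backlog N \<sigma> 0 T \<omega>))" using int by simp
    show "integrable (sample N) (indicator ?G :: _ \<Rightarrow> real)" using G by (simp add: emeasure_eq_measure)
    fix \<omega>
    show "1 - e * F (qla_backlog N \<sigma> 0 T \<omega>) \<le> indicator ?G \<omega>"
    proof (cases "\<omega> \<in> ?G")
      case False
      hence "\<theta> * (margin / 2) \<le> \<theta> * R (qla_backlog N \<sigma> 0 T \<omega>)"
        using \<theta>_pos by (intro mult_left_mono) auto
      hence "1 \<le> e * F (qla_backlog N \<sigma> 0 T \<omega>)" by (simp add: e_def exp_add[symmetric])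
      thus ?thesis using False by simp
    qed (simp add: e_def)
  qed
  also have "\<dots> = measure (sample N) ?G" using G by simp
  finally have low: "1 - e * transition N \<sigma> T F 0 \<le> measure (sample N) ?G" .
  have "transition N \<sigma> T F 0 \<le> 1 + M * V / \<kappa>"
    using exp_moment[OF nn, of T] T by linarith
  also have "\<dots> \<le> (1 + M / \<kappa>) * V" using V by (simp add: distrib_right)
  also have "\<dots> \<le> C * V" using C V by (intro mult_right_mono) auto
  finally have "e * transition N \<sigma> T F 0 \<le> e * (C * V)" by (intro mult_left_mono) (auto simp: e_def)
  also have "\<dots> = C * (e * V)" by simp
  also have "\<dots> \<le> C * (1 / V ^ 4)"
  proof (rule mult_left_mono)
    have "ln V - a * (ln V)\<^sup>2 / 2 \<le> - (4 * ln V)"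
      using square_ln_dominates[OF V'] V'(2) by linarith
    moreover have "e * V = exp (ln V - a * (ln V)\<^sup>2 / 2)"
      using V_exp_tail by (simp only: e_def mult.commute)
    moreover have "1 / V ^ 4 = exp (- (4 * ln V))"
    proof -
      have "exp (4 * ln V) = V ^ 4" using V exp_of_nat_mult[of 4 "ln V"] by simp
      thus ?thesis by (simp only: exp_minus inverse_eq_divide)
    qed
    ultimately show "e * V \<le> 1 / V ^ 4" by simp
    have "0 \<le> M / \<kappa>" using \<kappa>_pos by (simp add: M_def)
    thus "0 \<le> C" using C by simp
  qed
  finally show ?thesis using low by simp
qed

text \<open>
  The influence of the empty initial state on the exponential moment decays geometrically. Once it is
  below \<open>1\<close>, the concentration bound applies at every later time \<open>T\<close>.
\<close>

lemma performance_general: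
  assumes V': "1 \<le> ln V" "10 / a \<le> ln V" "2 * K \<le> ln V"
    and C: "B \<le> C" "real CARD('r) * (3 * B / (L * K) + 3 / 2 + \<delta>) \<le> C" "2 * \<Delta> * M * a / \<kappa> \<le> C"
      "1 + M / \<kappa> \<le> C"
  shows "\<exists>T0. \<forall>T\<ge>T0. measure (sample N) {\<omega> \<in> space (sample N).
      fqla_performance N \<sigma> C (a / 4) V (general_threshold N V \<sigma> T \<omega>)} \<ge> 1 - C / V ^ 4"
proof -
  interpret prob_space "sample N" by (rule prob_space_sample)
  have "(\<lambda>T. (1 - \<kappa> / V) ^ T * F 0) \<longlonglongrightarrow> 0 * F 0"
    using \<kappa>_pos V V_large(3) by (intro tendsto_intros LIMSEQ_realpow_zero) auto
  from order_tendstoD(2)[OF this, of 1]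
  have "\<forall>\<^sub>F T in sequentially. (1 - \<kappa> / V) ^ T * F 0 < 1" by simp
  then obtain T0 where T0: "\<And>T. T \<ge> T0 \<Longrightarrow> (1 - \<kappa> / V) ^ T * F 0 \<le> 1"
    unfolding eventually_sequentially by (meson less_imp_le)
  show ?thesis
  proof (intro exI allI impI)
    fix T assume "T \<ge> T0"
    have "1 - C / V ^ 4 \<le> measure (sample N) {\<omega>. R (qla_backlog N \<sigma> 0 T \<omega>) \<le> margin / 2}"
      using V' by (intro margin_concentration T0[OF \<open>T \<ge> T0\<close>] C) auto
    also have "\<dots> \<le> measure (sample N) {\<omega> \<in> space (sample N).
        fqla_performance N \<sigma> C (a / 4) V (general_threshold N V \<sigma> T \<omega>)}"
    proof (rule finite_measure_mono)
      show "{\<omega>. R (qla_backlog N \<sigma> 0 T \<omega>) \<le> margin / 2} \<subseteq> {\<omega> \<in> space (sample N).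
          fqla_performance N \<sigma> C (a / 4) V (general_threshold N V \<sigma> T \<omega>)}"
        using performance_near[OF _ V' C(1-3)] by (auto simp: general_threshold_def)
      have "(\<lambda>\<omega>. fqla_performance N \<sigma> C (a / 4) V (general_threshold N V \<sigma> T \<omega>))
          \<in> sample N \<rightarrow>\<^sub>M count_space UNIV"
        unfolding general_threshold_def
        by (rule measurable_determined[OF determined_comp[OF determined_qla_backlog]]) simp
      thus "{\<omega> \<in> space (sample N).
          fqla_performance N \<sigma> C (a / 4) V (general_threshold N V \<sigma> T \<omega>)} \<in> sets (sample N)"
        by (simp add: pred_def)
    qed
    finally show "1 - C / V ^ 4 \<le> measure (sample N) {\<omega> \<in> space (sample N).
        fqla_performance N \<sigma> C (a / 4) V (general_threshold N V \<sigma> T \<omega>)}" .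
  qed
qed

end

section \<open>The performance-delay tradeoff\<close>

theorem theorem7:
  fixes N :: "('s::finite, 'x::topological_space, 'r::finite) network"
    and \<sigma> :: "real \<Rightarrow> real ^ 'r \<Rightarrow> 's \<Rightarrow> 'x"
    and \<epsilon> L :: real
  assumes model: "network_model N"
    and unique: "\<And>V. V \<ge> 1 \<Longrightarrow> \<exists>!U. dual_maximizer N V U"
    and qla: "\<And>V. V \<ge> 1 \<Longrightarrow> qla_rule N V (\<sigma> V)"
    and pos: "\<epsilon> > 0" "L > 0"
    and smooth: "locally_smooth N \<epsilon> L"
    and steady: "\<And>V. V \<ge> 1 \<Longrightarrow> has_steady_state N (\<sigma> V)"
  shows "\<exists>(C::real) (c0::real) (T0 :: real \<Rightarrow> nat). C > 0 \<and> c0 > 0 \<and>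
    (\<forall>\<^sub>F V in at_top.
       fqla_performance N (\<sigma> V) C c0 V (ideal_threshold N V) \<and>
       (\<forall>T\<ge>T0 V.
          measure (sample N) {\<omega> \<in> space (sample N).
              fqla_performance N (\<sigma> V) C c0 V (general_threshold N V (\<sigma> V) T \<omega>)}
            \<ge> 1 - C / V ^ 4))"
proof -
  obtain \<delta> where \<delta>: "\<delta> > 0"
    and bound: "\<And>s x j. x \<in> acts N s \<Longrightarrow> \<bar>cost N s x\<bar> \<le> \<delta>"
      "\<And>s x j. x \<in> acts N s \<Longrightarrow> 0 \<le> arr N s x $ j \<and> arr N s x $ j \<le> \<delta>"
      "\<And>s x j. x \<in> acts N s \<Longrightarrow> 0 \<le> srv N s x $ j \<and> srv N s x $ j \<le> \<delta>"
    using model unfolding network_model_def by (meson abs_le_D1)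
  define B where "B = real CARD('r) * \<delta>\<^sup>2"
  define \<Delta> where "\<Delta> = real CARD('r) * \<delta>"
  \<comment> \<open>At distance \<open>K * sqrt V\<close> the quadratic gap \<open>(L / V) * D\<^sup>2\<close> of the dual equals the noise \<open>2 * B\<close>.\<close>
  define K where "K = sqrt (2 * B / L)"
  \<comment> \<open>\<open>a\<close> minimises \<open>(a * \<Delta>)\<^sup>2 - a * (L * K / 2)\<close>, and \<open>- \<kappa>\<close> is the minimum.\<close>
  define a where "a = L * K / (4 * \<Delta>\<^sup>2)"
  define \<kappa> where "\<kappa> = (L * K)\<^sup>2 / (16 * \<Delta>\<^sup>2)"
  define M where "M = exp (a * K + 1)"
  define C where "C = Max {B, real CARD('r) * (3 * B / (L * K) + 3 / 2 + \<delta>),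
    2 * \<Delta> * M * a / \<kappa>, 1 + M / \<kappa>}"
  have B: "B > 0" and \<Delta>: "\<Delta> > 0" using \<delta> by (auto simp: B_def \<Delta>_def)
  have K: "K > 0" "L * K\<^sup>2 = 2 * B" using B pos by (auto simp: K_def)
  have a: "a > 0" using K pos \<Delta> by (simp add: a_def)
  have C: "B \<le> C" "real CARD('r) * (3 * B / (L * K) + 3 / 2 + \<delta>) \<le> C"
    "2 * \<Delta> * M * a / \<kappa> \<le> C" "1 + M / \<kappa> \<le> C"
    by (auto simp: C_def)
  let ?perf = "\<lambda>V. fqla_performance N (\<sigma> V) C (a / 4) V"
  let ?reliable = "\<lambda>V T. measure (sample N) {\<omega> \<in> space (sample N).
      ?perf V (general_threshold N V (\<sigma> V) T \<omega>)} \<ge> 1 - C / V ^ 4"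
  have main: "?perf V (ideal_threshold N V) \<and> (\<exists>T0. \<forall>T\<ge>T0. ?reliable V T)"
    if large: "1 \<le> V" "K / \<epsilon> < sqrt V" "a * \<Delta> \<le> sqrt V" "\<kappa> \<le> V"
      and ln_large: "1 \<le> ln V" "10 / a \<le> ln V" "2 * K \<le> ln V" for V
  proof -
    interpret qla_chain N "\<sigma> V" V \<delta> B \<Delta>
      using large(1) \<delta> bound qla[OF large(1)] by unfold_locales (auto simp: B_def \<Delta>_def)
    define u where "u = V *\<^sub>R dual_opt N 1"
    note uniq = unique[OF order_refl] unique[OF large(1)]
    have "K * sqrt V < \<epsilon> * V"
    proof -
      have "K < \<epsilon> * sqrt V" using large(2) pos by (simp add: pos_divide_less_eq mult.commute)
      hence "K * sqrt V < \<epsilon> * sqrt V * sqrt V" using large(1) by (intro mult_strict_right_mono) auto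
      moreover have "\<epsilon> * sqrt V * sqrt V = \<epsilon> * V" using large(1) by simp
      ultimately show ?thesis by (simp only:)
    qed
    then interpret qla_concentration N "\<sigma> V" V \<delta> B \<Delta> u \<epsilon> L K a \<kappa> M
      using pos K large dual_opt_scaled(1,2)[OF uniq] quadratic_growth[OF uniq smooth]
      by unfold_locales (auto simp: a_def \<kappa>_def M_def u_def)
    have "0 \<le> margin" using large(1) by (simp add: margin_def)
    hence "?perf V (ideal_threshold N V)"
      unfolding ideal_threshold_def dual_opt_scaled(3)[OF uniq] u_def[symmetric]
      by (intro performance_near ln_large C) simp
    thus ?thesis using performance_general[OF ln_large C] by blast
  qed
  define T0 where "T0 V = (SOME T0. \<forall>T\<ge>T0. ?reliable V T)" for V
  have ln_large: "\<forall>\<^sub>F V in at_top. x \<le> ln V" for x :: real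
    using ln_at_top by (simp add: filterlim_at_top)
  have sqrt_large: "\<forall>\<^sub>F V in at_top. x < sqrt V" for x :: real
    using sqrt_at_top by (simp add: filterlim_at_top_dense)
  have "\<forall>\<^sub>F V in at_top. ?perf V (ideal_threshold N V) \<and> (\<forall>T\<ge>T0 V. ?reliable V T)"
    using eventually_ge_at_top[of 1] sqrt_large[of "K / \<epsilon>"] sqrt_large[of "a * \<Delta>"]
      eventually_ge_at_top[of \<kappa>] ln_large[of 1] ln_large[of "10 / a"] ln_large[of "2 * K"]
  proof eventually_elim
    case (elim V)
    hence m: "?perf V (ideal_threshold N V)" "\<exists>T0. \<forall>T\<ge>T0. ?reliable V T"
      using main[of V] by auto
    have "\<forall>T\<ge>T0 V. ?reliable V T" unfolding T0_def by (rule someI_ex[OF m(2)])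
    with m(1) show ?case by blast
  qed
  moreover have "C > 0" "a / 4 > 0" using C(1) B a by auto
  ultimately show ?thesis by blast
qed

end
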